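(* Fix any $\beta\in[0,\frac12)$. There exist constants $C,c>0$ depending only on $\beta$ such that for all integers $K\ge2$, $N\ge1$ and any $\sigma^2>0$, $$\inf_{\hat\theta}\sup_{\theta^*\in\mathcal{P}_\beta}\mathbb{E}_{\theta^*}[L(\theta^*,\hat\theta)]\ \ge\ c\cdot\min\left(\frac1N\cdot\max\Big(K\sigma^2,\ \frac{K^{4\beta}\sigma^6}{e^{CK^{1-2\beta}/\sigma^2}}\Big),\ K^{1-2\beta}\right),$$ where the infimum is over all estimators $\hat\theta=\hat\theta(y^{(1)},\dots,y^{(N)})\in\mathbb{R}^{2K}$.
   Context: For $\theta=(\theta_{1,1},\theta_{1,2},\dots,\theta_{K,1},\theta_{K,2})\in\mathbb{R}^{2K}$ let $r_k(\theta)=(\theta_{k,1}^2+\theta_{k,2}^2)^{1/2}$, and $\mathcal{P}_\beta=\{\theta^*\in\mathbb{R}^{2K}:r_k(\theta^* )=k^{-\beta}\text{ for all }k=1,\dots,K\}$. For $\alpha\in\mathcal{A}=[-\pi,\pi)$, $g(\alpha)\in\mathbb{R}^{2K\times2K}$ is block diagonal with $k$-th $2\times 2$ block $\begin{pmatrix}\cos k\alpha&-\sin k\alpha\\ \sin k\alpha&\cos k\alpha\end{pmatrix}$. Model: $y^{(m)}=g(\alpha^{(m)})\theta^*+\sigma\varepsilon^{(m)}$, $m=1,\dots,N$, with $\alpha^{(m)}$ i.i.d. uniform on $[-\pi,\pi)$, $\varepsilon^{(m)}$ i.i.d. $\mathcal{N}(0,I_{2K})$, all independent; $\mathbb{E}_{\theta^*}$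 is expectation under this model. Loss: $L(\theta,\theta')=\min_{\alpha\in\mathcal{A}}\|\theta-g(\alpha)\theta'\|^2$ (symmetric in its arguments). *)

theory Defs
  imports "HOL-Probability.Probability"
begin

(* The dimension 2K varies inside the statement, so a vector of R^{2K} is a function on the
   finite index set coords K, with the coordinate theta_{k,j} at index (k, j); as usual for
   product measures, it takes the value undefined outside coords K. *)

type_synonym vec = "nat \<times> nat \<Rightarrow> real"

definition coords :: "nat \<Rightarrow> (nat \<times> nat) set" where
  "coords K = {1..K} \<times> {1, 2}"

definition vecs :: "nat \<Rightarrow> vec measure" where
  "vecs K = Pi\<^sub>M (coords K) (\<lambda>_. borel)"

definition sq_norm :: "nat \<Rightarrow> vec \<Rightarrow> real" where
  "sq_norm K v = (\<Sum>p\<in>coords K. (v p)\<^sup>2)"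

definition r :: "vec \<Rightarrow> nat \<Rightarrow> real" where
  "r \<theta> k = sqrt ((\<theta> (k, 1))\<^sup>2 + (\<theta> (k, 2))\<^sup>2)"

definition param_class :: "real \<Rightarrow> nat \<Rightarrow> vec set" where
  "param_class \<beta> K = {\<theta> \<in> space (vecs K). \<forall>k\<in>{1..K}. r \<theta> k = real k powr (-\<beta>)}"

definition g :: "real \<Rightarrow> nat \<times> nat \<Rightarrow> nat \<times> nat \<Rightarrow> real" where
  "g \<alpha> p q = (case (p, q) of ((k, i), (l, j)) \<Rightarrow>
     if k \<noteq> l then 0
     else if i = j then cos (real k * \<alpha>)
     else if i = 1 then - sin (real k * \<alpha>)
     else sin (real k * \<alpha>))"

definition g_apply :: "nat \<Rightarrow> real \<Rightarrow> vec \<Rightarrow> vec" where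
  "g_apply K \<alpha> \<theta> = (\<lambda>p\<in>coords K. \<Sum>q\<in>coords K. g \<alpha> p q * \<theta> q)"

(* The infimum is a minimum, see loss_attained below. *)
definition loss :: "nat \<Rightarrow> vec \<Rightarrow> vec \<Rightarrow> real" where
  "loss K \<theta> \<theta>' = (INF \<alpha>\<in>{-pi..<pi}. sq_norm K (\<lambda>p. \<theta> p - g_apply K \<alpha> \<theta>' p))"

(* Joint law of the latent pairs (alpha^(m), epsilon^(m)), m = 1, ..., N. *)
definition latent :: "nat \<Rightarrow> nat \<Rightarrow> (nat \<Rightarrow> real \<times> vec) measure" where
  "latent K N = Pi\<^sub>M {1..N} (\<lambda>_.
     uniform_measure lborel {-pi..<pi} \<Otimes>\<^sub>M Pi\<^sub>M (coords K) (\<lambda>_. std_normal_distribution))"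

definition obs :: "nat \<Rightarrow> nat \<Rightarrow> real \<Rightarrow> vec \<Rightarrow> (nat \<Rightarrow> real \<times> vec) \<Rightarrow> (nat \<Rightarrow> vec)" where
  "obs K N \<sigma> \<theta> \<omega> = (\<lambda>m\<in>{1..N}. \<lambda>p\<in>coords K.
     g_apply K (fst (\<omega> m)) \<theta> p + \<sigma> * snd (\<omega> m) p)"

definition estimators :: "nat \<Rightarrow> nat \<Rightarrow> ((nat \<Rightarrow> vec) \<Rightarrow> vec) set" where
  "estimators K N = measurable (Pi\<^sub>M {1..N} (\<lambda>_. vecs K)) (vecs K)"

(* Expectation of the nonnegative loss as a Lebesgue integral in [0, infinity]: an estimator
   need not have finite risk, for which the Bochner integral would return 0. *)
definition risk :: "nat \<Rightarrow> nat \<Rightarrow> real \<Rightarrow> ((nat \<Rightarrow> vec) \<Rightarrow> vec) \<Rightarrow> vec \<Rightarrow> ennreal" where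
  "risk K N \<sigma> est \<theta> = (\<integral>\<^sup>+ \<omega>. ennreal (loss K \<theta> (est (obs K N \<sigma> \<theta> \<omega>))) \<partial>latent K N)"

definition minimax_risk :: "real \<Rightarrow> nat \<Rightarrow> nat \<Rightarrow> real \<Rightarrow> ennreal" where
  "minimax_risk \<beta> K N \<sigma> = (INF est\<in>estimators K N. SUP \<theta>\<in>param_class \<beta> K. risk K N \<sigma> est \<theta>)"

lemma loss_attained:
  "\<exists>\<alpha>\<in>{-pi..<pi}. loss K \<theta> \<theta>' = sq_norm K (\<lambda>p. \<theta> p - g_apply K \<alpha> \<theta>' p)
     \<and> (\<forall>\<alpha>'\<in>{-pi..<pi}. loss K \<theta> \<theta>' \<le> sq_norm K (\<lambda>p. \<theta> p - g_apply K \<alpha>' \<theta>' p))"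
proof -
  define f where "f \<alpha> = sq_norm K (\<lambda>p. \<theta> p - g_apply K \<alpha> \<theta>' p)" for \<alpha>
  have cg: "continuous_on S (\<lambda>\<alpha>. g \<alpha> p q)" for S p q
    by (cases "fst p = fst q"; cases "snd p = snd q"; cases "snd p = 1")
       (auto simp: g_def case_prod_beta intro!: continuous_intros)
  have "continuous_on {-pi..pi} f"
    unfolding f_def sq_norm_def g_apply_def
    by (auto intro!: continuous_intros cg)
  then obtain a where a: "a \<in> {-pi..pi}" "\<And>x. x \<in> {-pi..pi} \<Longrightarrow> f a \<le> f x"
    using continuous_attains_inf[of "{-pi..pi}" f] by auto
  have "g pi p q = g (-pi) p q" for p q
    by (cases p; cases q) (auto simp: g_def)
  hence per: "f pi = f (-pi)" by (simp add: f_def g_apply_def)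
  obtain b where b: "b \<in> {-pi..<pi}" "\<And>x. x \<in> {-pi..<pi} \<Longrightarrow> f b \<le> f x"
  proof (cases "a = pi")
    case True
    show ?thesis by (rule that[of "-pi"]) (use a per True in auto)
  next
    case False
    show ?thesis by (rule that[of a]) (use a False in auto)
  qed
  have "Inf (f ` {-pi..<pi}) = f b"
    by (rule cInf_eq_minimum) (use b in auto)
  thus ?thesis using b unfolding loss_def f_def[symmetric] by auto
qed

lemma prob_space_latent: "prob_space (latent K N)"
proof -
  have u: "prob_space (uniform_measure lborel {-pi..<pi})"
    by (rule prob_space_uniform_measure) auto
  have n: "prob_space (Pi\<^sub>M (coords K) (\<lambda>_. std_normal_distribution))"
    by (intro prob_space_PiM prob_space_normal_density) simp_all
  show ?thesis
    unfolding latent_def by (rule prob_space_PiM[OF prob_space_pair[OF u n]])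
qed

lemma obs_measurable: "obs K N \<sigma> \<theta> \<in> measurable (latent K N) (Pi\<^sub>M {1..N} (\<lambda>_. vecs K))"
proof -
  have [measurable]: "(\<lambda>\<alpha>. g \<alpha> p q) \<in> borel_measurable borel" for p q
    by (cases "fst p = fst q"; cases "snd p = snd q"; cases "snd p = 1")
       (auto simp: g_def case_prod_beta)
  show ?thesis
    unfolding obs_def latent_def vecs_def g_apply_def
    by (intro measurable_restrict) (auto intro!: measurable_restrict, measurable)
qed

end

theory Submission
  imports Defs
begin

text \<open>
  Assouad's method. For even frequencies l with K/2 < l \<le> K, the hypotheses put the phase of the
  l-th coordinate at one of two conjugate values at distance 2x, and leave all other phases at 0.
  The loss is at least the sum of the losses restricted to the disjoint frequency pairs (l/2, l),
  and on such a pair the rotation is pinned down by frequency l/2, so each of the order of K signs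
  costs a multiple of x^2. It remains to choose x such that N observations do not reveal a sign,
  i.e. such that the chi-square divergence between the laws of one observation, which are uniform
  mixtures of Gaussians over the rotations, is of the order 1/N.

  If the rotations were observed, the divergence would be exp(4x^2/sigma^2) - 1, which gives the
  term with K sigma^2. Otherwise, up to a factor exp(O(snr)), the divergence is the difference of
  E exp(X) and E exp(X'), where X is the cosine polynomial of the angle with coefficients
  k^(-2 beta) / sigma^2, and X' has the phase at frequency l shifted. As l > K/2, the terms of order
  0 and 1 in the coordinates other than l vanish. The terms of order m \<ge> 2 are Fourier coefficients
  at multiples of l of m-th powers, and these decay like 1/l since k times the k-th coefficient is
  bounded by K^(1 - 2 beta) / sigma^2. This gives x^2 K^(1 - 4 beta) / sigma^6 and the other term.
\<close>

section \<open>Fourier coefficients of exponentials of cosine polynomials\<close>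

text \<open>Write snr for the squared norm of a hypothesis over sigma^2. Hiding the rotations has to
  gain a factor of order snr^2 / K over the divergence of order x^2 / sigma^2 of the observed model.
  The decay of the Fourier coefficients yields snr / K. The second power of snr would be lost if the
  first order in X survived, so no multiple of l other than l itself may be a frequency of the
  model. The denominator of the chi-square divergence is removed by a pointwise lower bound on the
  mixture density. This bound costs a factor exponential in snr, which the statement allows. What
  remains is a squared distance in L^2 of pure noise, and the inner products in it are expectations
  over the difference of two independent angles. The cap K^(1 - 2 beta) of the minimum appears
  because x cannot exceed the smallest radius K^(-beta).\<close>

lemma abs_sin_mult_le: "\<bar>sin (of_nat n * s)\<bar> \<le> of_nat n * \<bar>sin (s::real)\<bar>"
proof (induction n)
  case (Suc n)
  have "\<bar>sin (of_nat (Suc n) * s)\<bar> = \<bar>sin (of_nat n * s) * cos s + cos (of_nat n * s) * sin s\<bar>"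
    by (simp add: distrib_right sin_add algebra_simps)
  also have "\<dots> \<le> \<bar>sin (of_nat n * s)\<bar> * \<bar>cos s\<bar> + \<bar>cos (of_nat n * s)\<bar> * \<bar>sin s\<bar>"
    by (metis abs_triangle_ineq abs_mult)
  also have "\<dots> \<le> \<bar>sin (of_nat n * s)\<bar> * 1 + 1 * \<bar>sin s\<bar>"
    by (intro add_mono mult_mono) auto
  finally show ?case using Suc by (simp add: algebra_simps)
qed simp

text \<open>The half-angle formula reduces this to \<open>abs_sin_mult_le\<close>. It compares a
  phase shift seen at the n-th harmonic with \<open>1 - cos t\<close>, the quantity that later
  becomes a multiple of x^2.\<close>

lemma one_minus_cos_mult_le:
  "1 - cos (of_int n * t) \<le> (of_int n)\<^sup>2 * (1 - cos (t::real))"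
proof -
  have half: "1 - cos x = 2 * (sin (x/2))\<^sup>2" for x :: real
    using cos_double_sin[of "x/2"] by simp
  have "\<bar>sin (of_int n * (t/2))\<bar> \<le> \<bar>of_int n\<bar> * \<bar>sin (t/2)\<bar>"
    using abs_sin_mult_le[of "nat \<bar>n\<bar>" "t/2"] by (cases "n \<ge> 0") auto
  hence "\<bar>sin (of_int n * (t/2))\<bar>\<^sup>2 \<le> (\<bar>of_int n\<bar> * \<bar>sin (t/2)\<bar>)\<^sup>2"
    by (rule power_mono) simp
  thus ?thesis unfolding half by (simp add: power_mult_distrib)
qed

text \<open>Termwise integration is dominated by the series of \<open>exp B * W\<close>. It allows
  expectations of exponentials to be estimated order by order.\<close>

lemma (in prob_space) expectation_exp_mult_sums:
  fixes X w :: "'a \<Rightarrow> real"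
  assumes [measurable]: "X \<in> borel_measurable M" "w \<in> borel_measurable M"
    and X: "\<And>x. \<bar>X x\<bar> \<le> B" and w: "\<And>x. \<bar>w x\<bar> \<le> W"
  shows "(\<lambda>m. expectation (\<lambda>x. X x ^ m * w x) / fact m) sums expectation (\<lambda>x. exp (X x) * w x)"
proof -
  have bd: "\<bar>X x ^ m * w x / fact m\<bar> \<le> B ^ m / fact m * W" for x m
  proof -
    have "\<bar>X x ^ m * w x\<bar> \<le> B ^ m * W"
      unfolding abs_mult power_abs by (intro mult_mono power_mono X w) (use X[of x] in auto)
    thus ?thesis by (simp add: divide_right_mono)
  qed
  have int: "integrable M (\<lambda>x. X x ^ m * w x / fact m)" for m
    by (rule integrable_const_bound[where B="B ^ m / fact m * W"]) (use bd in auto)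
  have sB: "summable (\<lambda>m. B ^ m / fact m * W)"
    using summable_exp[of B] by (intro summable_mult2) (simp add: field_simps)
  have "(\<lambda>m. expectation (\<lambda>x. X x ^ m * w x / fact m)) sums
          expectation (\<lambda>x. \<Sum>m. X x ^ m * w x / fact m)"
  proof (rule sums_integral[OF int])
    show "AE x in M. summable (\<lambda>m. norm (X x ^ m * w x / fact m))"
      using bd by (intro AE_I2 summable_comparison_test[OF _ sB]) auto
    have "expectation (\<lambda>x. norm (X x ^ m * w x / fact m)) \<le> B ^ m / fact m * W" for m
    proof -
      have "expectation (\<lambda>x. norm (X x ^ m * w x / fact m)) \<le> expectation (\<lambda>x. B ^ m / fact m * W)"
        by (intro integral_mono integrable_norm int integrable_const) (use bd in simp)
      thus ?thesis by (simp add: prob_space)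
    qed
    thus "summable (\<lambda>m. expectation (\<lambda>x. norm (X x ^ m * w x / fact m)))"
      by (intro summable_comparison_test[OF _ sB]) auto
  qed
  moreover have "(\<Sum>m. X x ^ m * w x / fact m) = exp (X x) * w x" for x
  proof -
    have "(\<lambda>m. X x ^ m / fact m * w x) sums (exp (X x) * w x)"
      using exp_converges[of "X x"] by (intro sums_mult2) (simp add: field_simps)
    thus ?thesis by (simp add: sums_iff)
  qed
  ultimately show ?thesis by simp
qed

section \<open>Effect of a phase shift at one frequency under a general weight\<close>

locale circle_variable = prob_space M for M :: "'a measure" +
  fixes \<gamma> :: "'a \<Rightarrow> real"
  assumes angle_measurable[measurable]: "\<gamma> \<in> borel_measurable M"
    and expectation_cos: "\<And>n::int. n \<noteq> 0 \<Longrightarrow> expectation (\<lambda>w. cos (of_int n * \<gamma> w)) = 0"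
    and expectation_sin: "\<And>n::int. expectation (\<lambda>w. sin (of_int n * \<gamma> w)) = 0"
begin

lemma integrable_bounded:
  fixes f :: "'a \<Rightarrow> real"
  assumes "f \<in> borel_measurable M" "\<And>x. \<bar>f x\<bar> \<le> B"
  shows "integrable M f"
  by (rule integrable_const_bound[where B=B]) (use assms in auto)

text \<open>Without powers, expanding the shifted cosine leaves \<open>1 - cos (n * t)\<close> times
  a coefficient of \<open>Z\<close>, since the sine part vanishes by \<open>odd\<close>; n = 0
  contributes nothing, so \<open>coeff\<close> can leave it out. Each further power of the cosine is
  traded by product-to-sum for the harmonics n + 1 and n - 1, which is why n is arbitrary in the
  induction and |n| + j is the natural size.\<close>

lemma shift_difference_bound:
  fixes Z :: "'a \<Rightarrow> real" and t :: real and l :: int and j :: nat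
  assumes [measurable]: "Z \<in> borel_measurable M" and Z: "\<And>w. \<bar>Z w\<bar> \<le> B"
    and odd: "\<And>n::int. expectation (\<lambda>w. Z w * sin (of_int n * (of_int l * \<gamma> w))) = 0"
    and coeff: "\<And>n::int. n \<noteq> 0 \<Longrightarrow>
      \<bar>expectation (\<lambda>w. Z w * cos (of_int n * (of_int l * \<gamma> w)))\<bar> \<le> \<kappa>"
    and \<kappa>: "0 \<le> \<kappa>"
  shows "\<bar>expectation (\<lambda>w. Z w * (cos (of_int n * (of_int l * \<gamma> w)) * cos (of_int l * \<gamma> w) ^ j
            - cos (of_int n * (of_int l * \<gamma> w + t)) * cos (of_int l * \<gamma> w + t) ^ j))\<bar>
         \<le> (real_of_int \<bar>n\<bar> + real j)\<^sup>2 * (1 - cos t) * \<kappa>"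
proof (induction j arbitrary: n)
  case 0
  have i: "integrable M (\<lambda>w. Z w * cos (of_int n * (of_int l * \<gamma> w)))"
          "integrable M (\<lambda>w. Z w * sin (of_int n * (of_int l * \<gamma> w)))"
    by (rule integrable_bounded[where B="B * 1"], simp, unfold abs_mult, intro mult_mono Z,
        use order_trans[OF abs_ge_zero Z] in auto)+
  have "expectation (\<lambda>w. Z w * (cos (of_int n * (of_int l * \<gamma> w)) - cos (of_int n * (of_int l * \<gamma> w + t))))
      = expectation (\<lambda>w. (1 - cos (of_int n * t)) * (Z w * cos (of_int n * (of_int l * \<gamma> w)))
          + sin (of_int n * t) * (Z w * sin (of_int n * (of_int l * \<gamma> w))))"
    by (rule Bochner_Integration.integral_cong) (auto simp: distrib_left cos_add algebra_simps)
  also have "\<dots> = (1 - cos (of_int n * t)) * expectation (\<lambda>w. Z w * cos (of_int n * (of_int l * \<gamma> w)))"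
    using i odd[of n] by simp
  finally have *: "expectation (\<lambda>w. Z w * (cos (of_int n * (of_int l * \<gamma> w)) - cos (of_int n * (of_int l * \<gamma> w + t))))
     = \<dots>" .
  have "\<bar>(1 - cos (of_int n * t)) * expectation (\<lambda>w. Z w * cos (of_int n * (of_int l * \<gamma> w)))\<bar>
        \<le> (of_int n)\<^sup>2 * (1 - cos t) * \<kappa>"
  proof (cases "n = 0")
    case False
    show ?thesis unfolding abs_mult
      using one_minus_cos_mult_le[of n t] coeff[OF False] by (intro mult_mono) auto
  qed simp
  thus ?case by (simp add: *)
next
  case (Suc j)
  define e where "e n j = expectation (\<lambda>w. Z w * (cos (of_int n * (of_int l * \<gamma> w)) * cos (of_int l * \<gamma> w) ^ j
            - cos (of_int n * (of_int l * \<gamma> w + t)) * cos (of_int l * \<gamma> w + t) ^ j))" for n j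
  have i: "integrable M (\<lambda>w. Z w * (cos (of_int n * (of_int l * \<gamma> w)) * cos (of_int l * \<gamma> w) ^ j
            - cos (of_int n * (of_int l * \<gamma> w + t)) * cos (of_int l * \<gamma> w + t) ^ j))" for n j
  proof (rule integrable_bounded[where B="B * (1 * 1 + 1 * 1)"])
    fix w
    have p: "\<bar>cos x * cos y ^ j\<bar> \<le> 1 * 1" for x y :: real
      unfolding abs_mult power_abs by (intro mult_mono power_le_one) auto
    show "\<bar>Z w * (cos (of_int n * (of_int l * \<gamma> w)) * cos (of_int l * \<gamma> w) ^ j
            - cos (of_int n * (of_int l * \<gamma> w + t)) * cos (of_int l * \<gamma> w + t) ^ j)\<bar> \<le> B * (1 * 1 + 1 * 1)"
      unfolding abs_mult
      by (intro mult_mono Z order_trans[OF abs_triangle_ineq4 add_mono[OF p p]])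
         (use order_trans[OF abs_ge_zero Z] in auto)
  qed simp
  have cc: "cos (of_int n * y) * cos y ^ Suc j
     = (cos (of_int (n+1) * y) * cos y ^ j + cos (of_int (n-1) * y) * cos y ^ j) / 2" for y :: real
    by (simp add: distrib_right left_diff_distrib cos_add cos_diff algebra_simps)
  have "e n (Suc j) = expectation (\<lambda>w. (Z w * (cos (of_int (n+1) * (of_int l * \<gamma> w)) * cos (of_int l * \<gamma> w) ^ j
            - cos (of_int (n+1) * (of_int l * \<gamma> w + t)) * cos (of_int l * \<gamma> w + t) ^ j)
        + Z w * (cos (of_int (n-1) * (of_int l * \<gamma> w)) * cos (of_int l * \<gamma> w) ^ j
            - cos (of_int (n-1) * (of_int l * \<gamma> w + t)) * cos (of_int l * \<gamma> w + t) ^ j)) / 2)"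
    unfolding e_def cc by (rule Bochner_Integration.integral_cong) (auto simp: field_simps)
  also have "\<dots> = (e (n+1) j + e (n-1) j) / 2"
    unfolding e_def using i[of "n+1" j] i[of "n-1" j] by simp
  finally have "\<bar>e n (Suc j)\<bar> \<le> (\<bar>e (n+1) j\<bar> + \<bar>e (n-1) j\<bar>) / 2" by auto
  also have "\<dots> \<le> ((real_of_int \<bar>n\<bar> + real (Suc j))\<^sup>2 * (1 - cos t) * \<kappa>
                 + (real_of_int \<bar>n\<bar> + real (Suc j))\<^sup>2 * (1 - cos t) * \<kappa>) / 2"
  proof -
    have "\<bar>e n' j\<bar> \<le> (real_of_int \<bar>n\<bar> + real (Suc j))\<^sup>2 * (1 - cos t) * \<kappa>" if "\<bar>n'\<bar> \<le> \<bar>n\<bar> + 1" for n'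
      by (rule order_trans[OF Suc.IH[folded e_def]], intro mult_right_mono power_mono)
         (use \<kappa> that in auto)
    thus ?thesis by (intro divide_right_mono add_mono) auto
  qed
  also have "\<dots> = (real_of_int \<bar>n\<bar> + real (Suc j))\<^sup>2 * (1 - cos t) * \<kappa>" by simp
  finally show ?case unfolding e_def .
qed

text \<open>Expand in powers of \<open>a * cos\<close> and apply
  \<open>shift_difference_bound\<close> with n = 0 to every order. Order 0 cancels, which yields the
  factor \<open>a\<close>; it must not be lost, because \<open>(1 - cos t) * a\<close> is what later
  turns into x^2.\<close>

lemma exp_cos_shift_bound:
  fixes Z :: "'a \<Rightarrow> real" and t a :: real and l :: int
  assumes [measurable]: "Z \<in> borel_measurable M" and Z: "\<And>w. \<bar>Z w\<bar> \<le> B"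
    and odd: "\<And>n::int. expectation (\<lambda>w. Z w * sin (of_int n * (of_int l * \<gamma> w))) = 0"
    and coeff: "\<And>n::int. n \<noteq> 0 \<Longrightarrow>
      \<bar>expectation (\<lambda>w. Z w * cos (of_int n * (of_int l * \<gamma> w)))\<bar> \<le> \<kappa>"
    and \<kappa>: "0 \<le> \<kappa>" and a: "0 \<le> a"
  shows "expectation (\<lambda>w. exp (a * cos (of_int l * \<gamma> w)) * Z w)
       - expectation (\<lambda>w. exp (a * cos (of_int l * \<gamma> w + t)) * Z w)
       \<le> (1 - cos t) * \<kappa> * a * exp (2 * a)"
proof -
  let ?x = "\<lambda>w. of_int l * \<gamma> w"
  have bd: "\<bar>a * cos y\<bar> \<le> a" for y :: real
    unfolding abs_mult using a by (simp add: mult_left_le)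
  have Bp: "0 \<le> B" using order_trans[OF abs_ge_zero Z] by auto
  have s1: "(\<lambda>m. expectation (\<lambda>w. (a * cos (?x w)) ^ m * Z w) / fact m) sums
          expectation (\<lambda>w. exp (a * cos (?x w)) * Z w)"
    by (rule expectation_exp_mult_sums[OF _ _ bd Z]) auto
  have s2: "(\<lambda>m. expectation (\<lambda>w. (a * cos (?x w + t)) ^ m * Z w) / fact m) sums
          expectation (\<lambda>w. exp (a * cos (?x w + t)) * Z w)"
    by (rule expectation_exp_mult_sums[OF _ _ bd Z]) auto
  define d where "d m = expectation (\<lambda>w. (a * cos (?x w)) ^ m * Z w) / fact m -
                  expectation (\<lambda>w. (a * cos (?x w + t)) ^ m * Z w) / fact m" for m
  have ds: "d sums (expectation (\<lambda>w. exp (a * cos (?x w)) * Z w)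
       - expectation (\<lambda>w. exp (a * cos (?x w + t)) * Z w))"
    unfolding d_def by (intro sums_diff s1 s2)
  have i: "integrable M (\<lambda>w. (a * cos (?x w + s)) ^ m * Z w)" for m s
    by (rule integrable_bounded[where B="a ^ m * B"], simp, unfold abs_mult[of "_ ^ _"] power_abs,
        intro mult_mono power_mono bd Z) (use a in auto)
  have d: "\<bar>d m\<bar> \<le> a ^ m / fact m * ((real m)\<^sup>2 * (1 - cos t) * \<kappa>)" for m
  proof -
    have "d m = expectation (\<lambda>w. (a * cos (?x w)) ^ m * Z w - (a * cos (?x w + t)) ^ m * Z w) / fact m"
      unfolding d_def using i[of 0 m] i[of t m] by (simp add: diff_divide_distrib)
    also have "\<dots> = a ^ m / fact m * expectation (\<lambda>w. Z w * (cos (of_int 0 * ?x w) * cos (?x w) ^ m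
          - cos (of_int 0 * (?x w + t)) * cos (?x w + t) ^ m))"
      unfolding power_mult_distrib
      by (subst integral_mult_right_zero[symmetric], subst integral_divide_zero[symmetric])
         (rule Bochner_Integration.integral_cong, auto simp: field_simps)
    finally have "\<bar>d m\<bar> = a ^ m / fact m * \<bar>expectation (\<lambda>w. Z w * (cos (of_int 0 * ?x w) * cos (?x w) ^ m
          - cos (of_int 0 * (?x w + t)) * cos (?x w + t) ^ m))\<bar>"
      using a by (simp add: abs_mult)
    also have "\<dots> \<le> a ^ m / fact m * ((real m)\<^sup>2 * (1 - cos t) * \<kappa>)"
      using shift_difference_bound[OF assms(1-5), of 0 m t] a by (intro mult_left_mono) auto
    finally show ?thesis .
  qed
  have d0: "d 0 = 0" by (simp add: d_def)
  have dS: "(\<lambda>m. d (Suc m)) sums (expectation (\<lambda>w. exp (a * cos (?x w)) * Z w)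
       - expectation (\<lambda>w. exp (a * cos (?x w + t)) * Z w))"
    using ds d0 by (subst sums_Suc_iff) simp
  have es: "(\<lambda>m. (1 - cos t) * \<kappa> * a * ((2 * a) ^ m / fact m)) sums ((1 - cos t) * \<kappa> * a * exp (2 * a))"
    using exp_converges[of "2 * a"] by (intro sums_mult) (simp add: field_simps)
  show ?thesis
  proof (rule sums_le[OF _ dS es])
    fix m
    \<comment> \<open>Of the two factors \<open>Suc m\<close> in the bound on \<open>d\<close>, one
      cancels against the factorial. The other is absorbed here, at the price of
      \<open>exp (2 * a)\<close> instead of \<open>exp a\<close>.\<close>
    have p: "real (Suc m) \<le> 2 ^ m"
    proof (induction m)
      case (Suc m)
      have "real (Suc (Suc m)) \<le> 2 * real (Suc m)" by simp
      also have "\<dots> \<le> 2 * 2 ^ m" using Suc by (intro mult_left_mono) auto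
      finally show ?case by simp
    qed simp
    have "d (Suc m) \<le> a ^ Suc m / fact (Suc m) * ((real (Suc m))\<^sup>2 * (1 - cos t) * \<kappa>)"
      using d[of "Suc m"] by linarith
    also have "\<dots> = (1 - cos t) * \<kappa> * a * (a ^ m / fact m) * real (Suc m)"
      by (simp add: power2_eq_square divide_simps del: of_nat_Suc)
    also have "\<dots> \<le> (1 - cos t) * \<kappa> * a * (a ^ m / fact m) * 2 ^ m"
      using p a \<kappa> by (intro mult_left_mono) auto
    also have "\<dots> = (1 - cos t) * \<kappa> * a * ((2 * a) ^ m / fact m)"
      by (simp add: power_mult_distrib)
    finally show "d (Suc m) \<le> (1 - cos t) * \<kappa> * a * ((2 * a) ^ m / fact m)" .
  qed
qed

end

section \<open>Fourier coefficients of powers and exponentials of a cosine polynomial\<close>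

locale cosine_polynomial = circle_variable M \<gamma> for M :: "'a measure" and \<gamma> +
  fixes A :: "nat set" and a :: "nat \<Rightarrow> real"
  assumes finA: "finite A" and a_nonneg: "\<And>k. k \<in> A \<Longrightarrow> 0 \<le> a k"
begin

definition "X w = (\<Sum>k\<in>A. a k * cos (real k * \<gamma> w))"
definition "S = (\<Sum>k\<in>A. a k)"
text \<open>The sine moments of \<open>X ^ m\<close> vanish
  (\<open>expectation_X_power_sin\<close>), so the cosine moment is the whole n-th Fourier
  coefficient.\<close>

definition "fc m n = expectation (\<lambda>w. X w ^ m * cos (of_int n * \<gamma> w))" for m :: nat and n :: int

lemma X_measurable[measurable]: "X \<in> borel_measurable M"
  unfolding X_def by measurable

lemma S_nonneg: "0 \<le> S"
  unfolding S_def by (intro sum_nonneg a_nonneg)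

lemma X_bound: "\<bar>X w\<bar> \<le> S"
  unfolding X_def S_def
  by (rule order_trans[OF sum_abs]) (auto intro!: sum_mono simp: abs_mult a_nonneg mult_left_le)

lemma X_power_bound: "\<bar>X w ^ m\<bar> \<le> S ^ m"
  unfolding power_abs by (intro power_mono X_bound) simp

lemma integrable_X_power_mult:
  assumes [measurable]: "f \<in> borel_measurable M" and "\<And>w. \<bar>f w\<bar> \<le> 1"
  shows "integrable M (\<lambda>w. X w ^ m * f w)"
  by (rule integrable_bounded[where B="S ^ m * 1"], simp, unfold abs_mult,
      intro mult_mono X_power_bound assms) (use S_nonneg in auto)

text \<open>Multiplication by \<open>X\<close> is convolution with its coefficient sequence, which
  has the value \<open>a k / 2\<close> at k and at -k.\<close>

lemma fc_Suc: "fc (Suc m) n = (\<Sum>k\<in>A. a k / 2 * (fc m (n + int k) + fc m (n - int k)))"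
proof -
  have "X w ^ Suc m * cos (of_int n * \<gamma> w) = (\<Sum>k\<in>A. a k / 2 *
      (X w ^ m * cos (of_int (n + int k) * \<gamma> w) + X w ^ m * cos (of_int (n - int k) * \<gamma> w)))" for w
  proof -
    have "a k / 2 * (X w ^ m * cos (of_int (n + int k) * \<gamma> w) + X w ^ m * cos (of_int (n - int k) * \<gamma> w))
       = a k * cos (real k * \<gamma> w) * (X w ^ m * cos (of_int n * \<gamma> w))" for k
      by (simp add: distrib_right left_diff_distrib cos_add cos_diff algebra_simps)
    thus ?thesis by (simp only: sum_distrib_right[symmetric] X_def[symmetric]) simp
  qed
  hence "fc (Suc m) n = expectation (\<lambda>w. \<Sum>k\<in>A. a k / 2 *
      (X w ^ m * cos (of_int (n + int k) * \<gamma> w) + X w ^ m * cos (of_int (n - int k) * \<gamma> w)))"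
    unfolding fc_def by simp
  also have "\<dots> = (\<Sum>k\<in>A. a k / 2 * (fc m (n + int k) + fc m (n - int k)))"
    unfolding fc_def
    by (subst Bochner_Integration.integral_sum)
       (auto intro!: sum.cong integrable_X_power_mult Bochner_Integration.integrable_add
          integrable_mult_right simp: integrable_X_power_mult)
  finally show ?thesis .
qed

lemma fc_0: "fc 0 n = (if n = 0 then 1 else 0)"
  using expectation_cos[of n] by (auto simp: fc_def prob_space)

lemma fc_1: "n \<noteq> 0 \<Longrightarrow> nat \<bar>n\<bar> \<notin> A \<Longrightarrow> fc 1 n = 0"
  unfolding One_nat_def fc_Suc fc_0
proof (intro sum.neutral ballI)
  fix k assume "n \<noteq> 0" "nat \<bar>n\<bar> \<notin> A" "k \<in> A"
  hence "\<bar>n\<bar> \<noteq> int k" by auto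
  hence "n + int k \<noteq> 0" "n - int k \<noteq> 0" by auto
  thus "a k / 2 * ((if n + int k = 0 then 1 else 0) + (if n - int k = 0 then 1 else 0)) = 0" by simp
qed

lemma expectation_X_power_sin: "expectation (\<lambda>w. X w ^ m * sin (of_int n * \<gamma> w)) = 0"
proof (induction m arbitrary: n)
  case (Suc m)
  have "X w ^ Suc m * sin (of_int n * \<gamma> w) = (\<Sum>k\<in>A. a k / 2 *
      (X w ^ m * sin (of_int (n + int k) * \<gamma> w) + X w ^ m * sin (of_int (n - int k) * \<gamma> w)))" for w
  proof -
    have "a k / 2 * (X w ^ m * sin (of_int (n + int k) * \<gamma> w) + X w ^ m * sin (of_int (n - int k) * \<gamma> w))
       = a k * cos (real k * \<gamma> w) * (X w ^ m * sin (of_int n * \<gamma> w))" for k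
      by (simp add: distrib_right left_diff_distrib sin_add sin_diff algebra_simps)
    thus ?thesis by (simp only: sum_distrib_right[symmetric] X_def[symmetric]) simp
  qed
  hence "expectation (\<lambda>w. X w ^ Suc m * sin (of_int n * \<gamma> w)) = expectation (\<lambda>w. \<Sum>k\<in>A. a k / 2 *
      (X w ^ m * sin (of_int (n + int k) * \<gamma> w) + X w ^ m * sin (of_int (n - int k) * \<gamma> w)))"
    by simp
  also have "\<dots> = 0"
    by (subst Bochner_Integration.integral_sum)
       (auto intro!: integrable_X_power_mult Bochner_Integration.integrable_add integrable_mult_right
          simp: Suc.IH integrable_X_power_mult simp del: of_int_add of_int_diff)
  finally show ?case .
qed (simp add: expectation_sin)

text \<open>The sum norm of Fourier coefficients is submultiplicative under convolution, and that of
  \<open>X\<close> is \<open>S\<close>.\<close>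

lemma sum_abs_fc_le: "finite F \<Longrightarrow> (\<Sum>n\<in>F. \<bar>fc m n\<bar>) \<le> S ^ m"
proof (induction m arbitrary: F)
  case 0
  have "(\<Sum>n\<in>F. \<bar>fc 0 n\<bar>) = (\<Sum>n\<in>F. if n = 0 then 1 else 0)"
    by (intro sum.cong) (auto simp: fc_0)
  thus ?case using 0 by simp
next
  case (Suc m)
  have sh: "(\<Sum>n\<in>F. \<bar>fc m (n + c)\<bar>) \<le> S ^ m" for c
    using Suc.IH[of "(\<lambda>n. n + c) ` F"] Suc.prems by (simp add: sum.reindex)
  have "(\<Sum>n\<in>F. \<bar>fc (Suc m) n\<bar>)
      \<le> (\<Sum>n\<in>F. \<Sum>k\<in>A. a k / 2 * (\<bar>fc m (n + int k)\<bar> + \<bar>fc m (n + (- int k))\<bar>))"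
    unfolding fc_Suc
    by (intro sum_mono order_trans[OF sum_abs])
       (auto simp: abs_mult a_nonneg intro!: mult_left_mono)
  also have "\<dots> = (\<Sum>k\<in>A. a k / 2 * ((\<Sum>n\<in>F. \<bar>fc m (n + int k)\<bar>) + (\<Sum>n\<in>F. \<bar>fc m (n + (- int k))\<bar>)))"
    by (subst sum.swap) (simp add: sum_distrib_left sum.distrib distrib_left)
  also have "\<dots> \<le> (\<Sum>k\<in>A. a k / 2 * (S ^ m + S ^ m))"
    by (intro sum_mono mult_left_mono add_mono sh) (auto simp: a_nonneg)
  also have "\<dots> = S ^ Suc m"
    by (simp add: S_def sum_distrib_right)
  finally show ?case .
qed

(* n * fc m n is, up to phase, the coefficient of a derivative, so the bound propagates by the product
   rule. The other factor has to be measured in the sum norm of its coefficients (sum_abs_fc_le):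
   bounding X ^ m uniformly instead would cost a factor card A. *)
lemma abs_fc_le:
  assumes Mb: "\<And>k. k \<in> A \<Longrightarrow> real k * a k \<le> Mb" and "0 \<le> Mb"
  shows "\<bar>of_int n * fc m n\<bar> \<le> real m * Mb * S ^ (m - 1)"
proof (induction m arbitrary: n)
  case 0
  show ?case by (simp add: fc_0)
next
  case (Suc m)
  let ?b = "real m * Mb * S ^ (m - 1)"
  have sh: "(\<Sum>k\<in>A. \<bar>fc m (n + s * int k)\<bar>) \<le> S ^ m" if "s \<noteq> 0" for s
  proof -
    have "inj_on (\<lambda>k. n + s * int k) A" using that by (auto simp: inj_on_def)
    thus ?thesis using sum_abs_fc_le[of "(\<lambda>k. n + s * int k) ` A" m] finA by (simp add: sum.reindex)
  qed
  \<comment> \<open>Writing n as (n + k) - k and as (n - k) + k separates the two terms of the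
    product rule. The first group falls under the induction hypothesis; in the second the derivative
    hits the new factor \<open>X\<close> and produces \<open>real k * a k\<close>.\<close>
  let ?s = "\<Sum>k\<in>A. a k / 2 *
      (of_int (n + int k) * fc m (n + int k) + of_int (n - int k) * fc m (n - int k))
       + real k * a k / 2 * (fc m (n - int k) - fc m (n + int k))"
  have "of_int n * fc (Suc m) n = ?s"
    unfolding fc_Suc sum_distrib_left
    by (intro sum.cong) (auto simp: field_simps)
  hence "\<bar>of_int n * fc (Suc m) n\<bar> = \<bar>?s\<bar>" by simp
  also have "\<bar>?s\<bar> \<le> (\<Sum>k\<in>A. a k / 2 * (?b + ?b)
       + Mb / 2 * (\<bar>fc m (n + (-1) * int k)\<bar> + \<bar>fc m (n + 1 * int k)\<bar>))"
  proof (rule order_trans[OF sum_abs], rule sum_mono, rule order_trans[OF abs_triangle_ineq], rule add_mono)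
    fix k assume k: "k \<in> A"
    show "\<bar>a k / 2 * (of_int (n + int k) * fc m (n + int k) + of_int (n - int k) * fc m (n - int k))\<bar>
        \<le> a k / 2 * (?b + ?b)"
      unfolding abs_mult
      by (intro mult_mono order_trans[OF abs_triangle_ineq add_mono[OF Suc.IH Suc.IH]])
         (use a_nonneg[OF k] in auto)
    have "\<bar>real k * a k / 2\<bar> * \<bar>fc m (n - int k) - fc m (n + int k)\<bar>
        \<le> Mb / 2 * (\<bar>fc m (n - int k)\<bar> + \<bar>fc m (n + int k)\<bar>)"
      using Mb[OF k] a_nonneg[OF k] \<open>0 \<le> Mb\<close> by (intro mult_mono abs_triangle_ineq4) auto
    thus "\<bar>real k * a k / 2 * (fc m (n - int k) - fc m (n + int k))\<bar>
        \<le> Mb / 2 * (\<bar>fc m (n + (-1) * int k)\<bar> + \<bar>fc m (n + 1 * int k)\<bar>)"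
      unfolding abs_mult by simp
  qed
  also have "\<dots> = S * ?b + Mb / 2 * ((\<Sum>k\<in>A. \<bar>fc m (n + (-1) * int k)\<bar>) + (\<Sum>k\<in>A. \<bar>fc m (n + 1 * int k)\<bar>))"
    unfolding S_def by (simp add: sum.distrib sum_distrib_left sum_distrib_right distrib_left ac_simps)
  also have "\<dots> \<le> S * ?b + Mb / 2 * (S ^ m + S ^ m)"
    using \<open>0 \<le> Mb\<close> by (intro add_left_mono mult_left_mono add_mono sh) auto
  \<comment> \<open>At m = 0 the truncated exponent \<open>m - 1\<close> does no harm, because the
    factor \<open>real m\<close> of \<open>?b\<close> vanishes.\<close>
  also have "\<dots> = real (Suc m) * Mb * S ^ (Suc m - 1)"
    by (cases m) (auto simp: algebra_simps)
  finally show ?case .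
qed

text \<open>The factor m in \<open>abs_fc_le\<close> cancels against the factorial, so the series is
  still of exponential type. Order 1 would be bounded only by \<open>Mb\<close> over |n|; since n
  lies outside \<open>A\<close> it vanishes, and every remaining order carries at least one factor
  \<open>S\<close>.\<close>

lemma exp_coefficient_bound:
  assumes Mb: "\<And>k. k \<in> A \<Longrightarrow> real k * a k \<le> Mb" and "0 \<le> Mb"
    and n: "n \<noteq> 0" "nat \<bar>n\<bar> \<notin> A"
  shows "\<bar>expectation (\<lambda>w. exp (X w) * cos (of_int n * \<gamma> w))\<bar> \<le> Mb * S * exp S / of_int \<bar>n\<bar>"
proof -
  let ?E = "expectation (\<lambda>w. exp (X w) * cos (of_int n * \<gamma> w))"
  have "(\<lambda>m. fc m n / fact m) sums ?E"
    unfolding fc_def by (rule expectation_exp_mult_sums[OF _ _ X_bound, where W=1]) auto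
  moreover have "fc 0 n = 0" "fc (Suc 0) n = 0"
    using n fc_1[of n] by (auto simp: fc_0)
  ultimately have s: "(\<lambda>m. fc (Suc (Suc m)) n / fact (Suc (Suc m))) sums ?E"
    by (subst sums_Suc_iff, subst sums_Suc_iff) simp
  have es: "(\<lambda>m. Mb * S / of_int \<bar>n\<bar> * (S ^ m / fact m)) sums (Mb * S / of_int \<bar>n\<bar> * exp S)"
    using exp_converges[of S] by (intro sums_mult) (simp add: field_simps)
  have b: "\<bar>fc (Suc (Suc m)) n / fact (Suc (Suc m))\<bar> \<le> Mb * S / of_int \<bar>n\<bar> * (S ^ m / fact m)" for m
  proof -
    have np: "0 < real_of_int \<bar>n\<bar>" using n by simp
    have "real_of_int \<bar>n\<bar> * \<bar>fc (Suc (Suc m)) n\<bar> \<le> real (Suc (Suc m)) * Mb * S ^ Suc m"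
      using abs_fc_le[OF Mb \<open>0 \<le> Mb\<close>, of n "Suc (Suc m)"] by (simp add: abs_mult)
    hence "\<bar>fc (Suc (Suc m)) n\<bar> / fact (Suc (Suc m)) \<le> real (Suc (Suc m)) * Mb * S ^ Suc m / of_int \<bar>n\<bar> / fact (Suc (Suc m))"
      using np by (intro divide_right_mono) (auto simp: field_simps)
    also have "\<dots> = Mb * S / of_int \<bar>n\<bar> * (S ^ m / fact (Suc m))"
      by (simp add: field_simps del: of_nat_Suc)
    also have "\<dots> \<le> Mb * S / of_int \<bar>n\<bar> * (S ^ m / fact m)"
      using S_nonneg \<open>0 \<le> Mb\<close> np
      by (intro mult_left_mono divide_left_mono fact_mono) auto
    finally show ?thesis by simp
  qed
  have "?E \<le> Mb * S / of_int \<bar>n\<bar> * exp S"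
    by (rule sums_le[OF _ s es]) (use b abs_le_D1 in blast)
  moreover have "- ?E \<le> Mb * S / of_int \<bar>n\<bar> * exp S"
    by (rule sums_le[OF _ sums_minus[OF s] es]) (use b abs_le_D2 in blast)
  ultimately show ?thesis by (simp add: abs_le_iff)
qed

lemma expectation_exp_X_sin: "expectation (\<lambda>w. exp (X w) * sin (of_int n * \<gamma> w)) = 0"
proof -
  have "(\<lambda>m. expectation (\<lambda>w. X w ^ m * sin (of_int n * \<gamma> w)) / fact m)
      sums expectation (\<lambda>w. exp (X w) * sin (of_int n * \<gamma> w))"
    by (rule expectation_exp_mult_sums[OF _ _ X_bound, where W=1]) auto
  thus ?thesis by (simp add: expectation_X_power_sin sums_iff)
qed

(* Since every multiple of l other than 0 is outside A, the orders 0 and 1 in X do not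
   contribute, which gives the bound its two factors Mb and S. *)
lemma phase_shift_bound:
  assumes Mb: "\<And>k. k \<in> A \<Longrightarrow> real k * a k \<le> Mb" and "0 \<le> Mb" "0 \<le> b"
    and l: "0 < l" "\<And>q. 0 < q \<Longrightarrow> q * l \<notin> A"
  shows "expectation (\<lambda>w. exp (X w + b * cos (real l * \<gamma> w)))
       - expectation (\<lambda>w. exp (X w + b * cos (real l * \<gamma> w + t)))
       \<le> (1 - cos t) * (Mb * S * exp S / real l) * b * exp (2 * b)"
proof -
  have "expectation (\<lambda>w. exp (b * cos (of_int (int l) * \<gamma> w)) * exp (X w))
       - expectation (\<lambda>w. exp (b * cos (of_int (int l) * \<gamma> w + t)) * exp (X w))
       \<le> (1 - cos t) * (Mb * S * exp S / real l) * b * exp (2 * b)"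
  proof (rule exp_cos_shift_bound[where B="exp S"])
    show "\<bar>exp (X w)\<bar> \<le> exp S" for w using X_bound[of w] by auto
    show "expectation (\<lambda>w. exp (X w) * sin (of_int n * (of_int (int l) * \<gamma> w))) = 0" for n
      using expectation_exp_X_sin[of "n * int l"] by (simp add: mult.assoc)
    show "0 \<le> Mb * S * exp S / real l" using \<open>0 \<le> Mb\<close> S_nonneg by simp
    fix n :: int assume n: "n \<noteq> 0"
    have "\<bar>expectation (\<lambda>w. exp (X w) * cos (of_int (n * int l) * \<gamma> w))\<bar>
        \<le> Mb * S * exp S / of_int \<bar>n * int l\<bar>"
    proof (rule exp_coefficient_bound[OF Mb \<open>0 \<le> Mb\<close>])
      have "nat \<bar>n * int l\<bar> = nat \<bar>n\<bar> * l" by (simp add: abs_mult nat_mult_distrib)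
      thus "nat \<bar>n * int l\<bar> \<notin> A" using l(2)[of "nat \<bar>n\<bar>"] n by simp
    qed (use n l in auto)
    \<comment> \<open>\<open>exp_cos_shift_bound\<close> asks for a bound uniform in n, so only the
      worst case n = 1 or n = -1 is kept.\<close>
    also have "\<dots> \<le> Mb * S * exp S / real l"
    proof (intro divide_left_mono)
      have "1 * int l \<le> \<bar>n\<bar> * int l" using n by (intro mult_right_mono) auto
      hence "int l \<le> \<bar>n * int l\<bar>" by (simp add: abs_mult)
      thus "real l \<le> of_int \<bar>n * int l\<bar>" by linarith
    qed (use n l \<open>0 \<le> Mb\<close> S_nonneg in auto)
    finally show "\<bar>expectation (\<lambda>w. exp (X w) * cos (of_int n * (of_int (int l) * \<gamma> w)))\<bar>
        \<le> Mb * S * exp S / real l"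
      by (simp add: mult.assoc)
  qed (use \<open>0 \<le> b\<close> in auto)
  thus ?thesis by (simp add: exp_add mult.commute)
qed

end

section \<open>Mixtures of Gaussian shifts\<close>

lemma PiM_density:
  assumes "finite I" and M: "\<And>i. prob_space (M i)" and D: "\<And>i. prob_space (density (M i) (f i))"
    and f[measurable]: "\<And>i. f i \<in> borel_measurable (M i)"
  shows "PiM I (\<lambda>i. density (M i) (f i)) = density (PiM I M) (\<lambda>x. \<Prod>i\<in>I. f i (x i))"
proof -
  interpret M: product_prob_space M by (rule product_prob_spaceI) (rule M)
  interpret D: product_prob_space "\<lambda>i. density (M i) (f i)" by (rule product_prob_spaceI) (rule D)
  show ?thesis
  proof (rule D.PiM_eqI[symmetric, OF \<open>finite I\<close>])
    show "sets (density (PiM I M) (\<lambda>x. \<Prod>i\<in>I. f i (x i))) = sets (PiM I (\<lambda>i. density (M i) (f i)))"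
      by (simp cong: sets_PiM_cong)
    fix A assume "\<And>i. i \<in> I \<Longrightarrow> A i \<in> sets (density (M i) (f i))"
    hence A[measurable]: "\<And>i. i \<in> I \<Longrightarrow> A i \<in> sets (M i)" by simp
    have "emeasure (density (PiM I M) (\<lambda>x. \<Prod>i\<in>I. f i (x i))) (Pi\<^sub>E I A)
        = (\<integral>\<^sup>+x. (\<Prod>i\<in>I. f i (x i)) * indicator (Pi\<^sub>E I A) x \<partial>PiM I M)"
      by (rule emeasure_density) (auto intro!: sets_PiM_I_finite A \<open>finite I\<close>)
    also have "\<dots> = (\<integral>\<^sup>+x. (\<Prod>i\<in>I. f i (x i) * indicator (A i) (x i)) \<partial>PiM I M)"
    proof (rule nn_integral_cong)
      fix x assume "x \<in> space (PiM I M)"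
      hence "x \<in> extensional I" by (simp add: space_PiM PiE_def)
      hence "indicator (Pi\<^sub>E I A) x = (\<Prod>i\<in>I. indicator (A i) (x i) :: ennreal)"
        using \<open>finite I\<close> by (auto simp: indicator_def PiE_def Pi_def intro!: prod_zero)
      thus "(\<Prod>i\<in>I. f i (x i)) * indicator (Pi\<^sub>E I A) x = (\<Prod>i\<in>I. f i (x i) * indicator (A i) (x i))"
        by (simp add: prod.distrib)
    qed
    also have "\<dots> = (\<Prod>i\<in>I. \<integral>\<^sup>+x. f i x * indicator (A i) x \<partial>M i)"
      by (rule M.product_nn_integral_prod[OF \<open>finite I\<close>]) (use A in measurable)
    also have "\<dots> = (\<Prod>i\<in>I. emeasure (density (M i) (f i)) (A i))"
      by (intro prod.cong refl emeasure_density[symmetric]) (use A in auto)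
    finally show "emeasure (density (PiM I M) (\<lambda>x. \<Prod>i\<in>I. f i (x i))) (Pi\<^sub>E I A)
        = (\<Prod>i\<in>I. emeasure (density (M i) (f i)) (A i))" .
  qed
qed

lemma distr_PiM_componentwise:
  assumes "finite I" and M: "\<And>i. prob_space (M i)"
    and f[measurable]: "\<And>i. f i \<in> measurable (M i) (N i)"
  shows "distr (PiM I M) (PiM I N) (\<lambda>x. \<lambda>i\<in>I. f i (x i)) = PiM I (\<lambda>i. distr (M i) (N i) (f i))"
proof -
  interpret M: product_prob_space M by (rule product_prob_spaceI) (rule M)
  interpret D: product_prob_space "\<lambda>i. distr (M i) (N i) (f i)"
    by (rule product_prob_spaceI) (rule prob_space.prob_space_distr[OF M f])
  show ?thesis
  proof (rule D.PiM_eqI[OF \<open>finite I\<close>])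
    show "sets (distr (PiM I M) (PiM I N) (\<lambda>x. \<lambda>i\<in>I. f i (x i)))
        = sets (PiM I (\<lambda>i. distr (M i) (N i) (f i)))"
      by (simp cong: sets_PiM_cong)
    fix A assume "\<And>i. i \<in> I \<Longrightarrow> A i \<in> sets (distr (M i) (N i) (f i))"
    hence A[measurable]: "\<And>i. i \<in> I \<Longrightarrow> A i \<in> sets (N i)" by simp
    have m: "(\<lambda>x. \<lambda>i\<in>I. f i (x i)) \<in> measurable (PiM I M) (PiM I N)"
      by (intro measurable_restrict) measurable
    have "(\<lambda>x. \<lambda>i\<in>I. f i (x i)) -` Pi\<^sub>E I A \<inter> space (PiM I M)
        = Pi\<^sub>E I (\<lambda>i. f i -` A i \<inter> space (M i))"
      by (auto simp: space_PiM PiE_def Pi_def)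
    hence "emeasure (distr (PiM I M) (PiM I N) (\<lambda>x. \<lambda>i\<in>I. f i (x i))) (Pi\<^sub>E I A)
        = emeasure (PiM I M) (Pi\<^sub>E I (\<lambda>i. f i -` A i \<inter> space (M i)))"
      using m A \<open>finite I\<close> by (subst emeasure_distr) (auto intro!: sets_PiM_I_finite)
    also have "\<dots> = (\<Prod>i\<in>I. emeasure (M i) (f i -` A i \<inter> space (M i)))"
      by (rule M.emeasure_PiM[OF \<open>finite I\<close>]) (use A f in measurable)
    also have "\<dots> = (\<Prod>i\<in>I. emeasure (distr (M i) (N i) (f i)) (A i))"
      by (intro prod.cong refl emeasure_distr[symmetric]) (use A in auto)
    finally show "emeasure (distr (PiM I M) (PiM I N) (\<lambda>x. \<lambda>i\<in>I. f i (x i))) (Pi\<^sub>E I A)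
        = (\<Prod>i\<in>I. emeasure (distr (M i) (N i) (f i)) (A i))" .
  qed
qed

section \<open>Likelihood ratios of Gaussian shifts\<close>

lemma normal_density_shift:
  assumes "0 < \<sigma>"
  shows "density (density lborel (normal_density 0 \<sigma>)) (\<lambda>x. ennreal (exp (a * x / \<sigma>\<^sup>2 - a\<^sup>2 / (2 * \<sigma>\<^sup>2))))
       = density lborel (normal_density a \<sigma>)"
proof -
  have "normal_density 0 \<sigma> x * exp (a * x / \<sigma>\<^sup>2 - a\<^sup>2 / (2 * \<sigma>\<^sup>2)) = normal_density a \<sigma> x" for x
  proof -
    have "- x\<^sup>2 / (2 * \<sigma>\<^sup>2) + (a * x / \<sigma>\<^sup>2 - a\<^sup>2 / (2 * \<sigma>\<^sup>2)) = - (x - a)\<^sup>2 / (2 * \<sigma>\<^sup>2)"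
      using assms by (simp add: field_simps power2_eq_square)
    thus ?thesis by (simp add: normal_density_def exp_add[symmetric])
  qed
  thus ?thesis
    by (subst density_density_eq) (auto simp: ennreal_mult'[symmetric] intro!: density_cong)
qed

lemma distr_std_normal_affine:
  assumes "0 < \<sigma>"
  shows "distr std_normal_distribution borel (\<lambda>x. a + \<sigma> * x) = density lborel (normal_density a \<sigma>)"
proof -
  interpret prob_space "std_normal_distribution" by (rule prob_space_normal_density) simp
  have "distributed std_normal_distribution lborel (\<lambda>x. x) (normal_density 0 1)"
    unfolding distributed_def by (auto intro!: measure_eqI simp: emeasure_distr)
  from normal_density_affine[OF this, of \<sigma> a] assms
  have "distr std_normal_distribution lborel (\<lambda>x. a + \<sigma> * x) = density lborel (normal_density a \<sigma>)"
    by (simp add: distributed_def)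
  moreover have "distr std_normal_distribution lborel (\<lambda>x. a + \<sigma> * x)
      = distr std_normal_distribution borel (\<lambda>x. a + \<sigma> * x)"
    by (rule distr_cong) auto
  ultimately show ?thesis by simp
qed

text \<open>The function x^2 / w is jointly convex, and the left side is its tangent plane at points
  of ratio c. As it is linear in (x, w), it can be averaged over a mixture.\<close>

lemma tangent_le_square_div:
  fixes c w x :: real
  assumes "0 < w"
  shows "2 * c * x - c\<^sup>2 * w \<le> x\<^sup>2 / w"
proof -
  have "0 \<le> (x - c * w)\<^sup>2" by simp
  hence "(2 * c * x - c\<^sup>2 * w) * w \<le> x\<^sup>2"
    by (simp add: power2_eq_square algebra_simps)
  thus ?thesis using assms by (simp add: pos_le_divide_eq)
qed

section \<open>Gaussian likelihoods averaged over a latent variable\<close>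

locale gaussian_mixture = prob_space U for U :: "'u measure" +
  fixes I :: "'i set" and \<sigma> :: real
  assumes finI: "finite I" and \<sigma>_pos: "0 < \<sigma>"
begin

text \<open>Pure noise is the reference measure instead of Lebesgue measure: it is a probability
  measure, and likelihoods relative to it are exponentials whose products integrate in closed
  form.\<close>

definition "Q = PiM I (\<lambda>_. density lborel (normal_density 0 \<sigma>))"

definition lik :: "('i \<Rightarrow> real) \<Rightarrow> ('i \<Rightarrow> real) \<Rightarrow> real" where
  "lik a y = exp (\<Sum>p\<in>I. a p * y p / \<sigma>\<^sup>2 - (a p)\<^sup>2 / (2 * \<sigma>\<^sup>2))"

text \<open>The bound is uniform in the latent variable, so every likelihood is a bounded function
  of it (\<open>lik_bounded\<close>) and all expectations over it are finite.\<close>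

definition adm :: "('u \<Rightarrow> 'i \<Rightarrow> real) \<Rightarrow> bool" where
  "adm a \<longleftrightarrow> (\<forall>p\<in>I. (\<lambda>u. a u p) \<in> borel_measurable U) \<and> (\<exists>B. \<forall>u. \<forall>p\<in>I. \<bar>a u p\<bar> \<le> B)"

text \<open>This is the density of one observation with respect to \<open>Q\<close>, see
  \<open>distr_observation\<close>.\<close>

definition mix :: "('u \<Rightarrow> 'i \<Rightarrow> real) \<Rightarrow> ('i \<Rightarrow> real) \<Rightarrow> real" where
  "mix a y = expectation (\<lambda>u. lik (a u) y)"

definition ip :: "('i \<Rightarrow> real) \<Rightarrow> ('i \<Rightarrow> real) \<Rightarrow> real" where
  "ip a b = (\<Sum>p\<in>I. a p * b p)"

lemma sets_Q[measurable_cong]: "sets Q = sets (PiM I (\<lambda>_. borel))"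
  unfolding Q_def by (intro sets_PiM_cong) auto

lemma prob_space_Q: "prob_space Q"
  unfolding Q_def by (intro prob_space_PiM prob_space_normal_density \<sigma>_pos)

sublocale Q: prob_space Q by (rule prob_space_Q)
sublocale QU: pair_prob_space U Q ..
sublocale UU: pair_prob_space U U ..

lemma adm_measurable: "adm a \<Longrightarrow> p \<in> I \<Longrightarrow> (\<lambda>u. a u p) \<in> borel_measurable U"
  by (auto simp: adm_def)

lemma lik_measurable_pair:
  assumes "adm a"
  shows "(\<lambda>(u, y). lik (a u) y) \<in> borel_measurable (U \<Otimes>\<^sub>M Q)"
proof -
  note [measurable] = adm_measurable[OF assms]
  show ?thesis unfolding lik_def by measurable
qed

lemma lik_measurable1:
  assumes "adm a"
  shows "(\<lambda>u. lik (a u) y) \<in> borel_measurable U"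
proof -
  note [measurable] = adm_measurable[OF assms]
  show ?thesis unfolding lik_def by measurable
qed

lemma lik_measurable2[measurable]: "lik a \<in> borel_measurable Q"
  unfolding lik_def[abs_def] by measurable

lemma lik_pos[simp]: "0 < lik a y" by (simp add: lik_def)

text \<open>Completing the square: up to a constant, the product is again a likelihood, with mean a
  + b, so its integral over \<open>Q\<close> is the exponential factor.\<close>

lemma lik_mult: "lik a y * lik b y = exp (ip a b / \<sigma>\<^sup>2) * lik (\<lambda>p. a p + b p) y"
  unfolding lik_def exp_add[symmetric] ip_def sum.distrib[symmetric] sum_divide_distrib
  using \<sigma>_pos
  by (intro arg_cong[of _ _ exp] sum.cong refl) (simp add: field_simps power2_eq_square)

text \<open>The same device with mean 2 b - a; the exponential factor is 1 plus the chi-square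
  divergence between the two Gaussians.\<close>

lemma lik_square_div:
  "(lik b y)\<^sup>2 / lik a y
    = exp ((\<Sum>p\<in>I. (b p - a p)\<^sup>2) / \<sigma>\<^sup>2) * lik (\<lambda>p. 2 * b p - a p) y"
  unfolding lik_def power2_eq_square[of "exp _"] exp_add[symmetric] exp_diff[symmetric]
    sum.distrib[symmetric] sum_divide_distrib sum_subtractf[symmetric]
  using \<sigma>_pos
  by (intro arg_cong[of _ _ exp] sum.cong refl) (simp add: field_simps power2_eq_square)

lemma distr_noise:
  "distr (PiM I (\<lambda>_. std_normal_distribution)) (PiM I (\<lambda>_. borel)) (\<lambda>e. \<lambda>p\<in>I. a p + \<sigma> * e p)
   = density Q (\<lambda>y. ennreal (lik a y))"
proof -
  have "distr (PiM I (\<lambda>_. std_normal_distribution)) (PiM I (\<lambda>_. borel)) (\<lambda>e. \<lambda>p\<in>I. a p + \<sigma> * e p)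
     = PiM I (\<lambda>p. distr std_normal_distribution borel (\<lambda>x. a p + \<sigma> * x))"
    by (rule distr_PiM_componentwise) (auto intro: finI prob_space_normal_density)
  also have "\<dots> = PiM I (\<lambda>p. density (density lborel (normal_density 0 \<sigma>))
      (\<lambda>x. ennreal (exp (a p * x / \<sigma>\<^sup>2 - (a p)\<^sup>2 / (2 * \<sigma>\<^sup>2)))))"
    by (simp only: distr_std_normal_affine[OF \<sigma>_pos] normal_density_shift[OF \<sigma>_pos])
  also have "\<dots> = density Q (\<lambda>y. \<Prod>p\<in>I. ennreal (exp (a p * y p / \<sigma>\<^sup>2 - (a p)\<^sup>2 / (2 * \<sigma>\<^sup>2))))"
    unfolding Q_def
  proof (rule PiM_density[OF finI])
    show "prob_space (density (density lborel (normal_density 0 \<sigma>))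
        (\<lambda>x. ennreal (exp (a p * x / \<sigma>\<^sup>2 - (a p)\<^sup>2 / (2 * \<sigma>\<^sup>2)))))" for p
      unfolding normal_density_shift[OF \<sigma>_pos] by (rule prob_space_normal_density[OF \<sigma>_pos])
  qed (auto intro: prob_space_normal_density \<sigma>_pos)
  also have "\<dots> = density Q (\<lambda>y. ennreal (lik a y))"
    by (simp add: lik_def exp_sum[OF finI] prod_ennreal)
  finally show ?thesis .
qed

text \<open>The normalization is read off from \<open>distr_noise\<close>, where the density is the
  image of a probability measure.\<close>

lemma nn_integral_lik: "(\<integral>\<^sup>+y. ennreal (lik a y) \<partial>Q) = 1"
proof -
  have "prob_space (density Q (\<lambda>y. ennreal (lik a y)))"
    unfolding distr_noise[symmetric]
    by (intro prob_space.prob_space_distr prob_space_PiM prob_space_normal_density measurable_restrict)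
       auto
  hence "emeasure (density Q (\<lambda>y. ennreal (lik a y))) (space Q) = 1"
    using prob_space.emeasure_space_1 by fastforce
  thus ?thesis by (simp add: emeasure_density cong: nn_integral_cong)
qed

lemma lik_bounded: assumes "adm a" shows "\<exists>B. \<forall>u. lik (a u) y \<le> B"
proof -
  from assms obtain B where B: "\<And>u p. p \<in> I \<Longrightarrow> \<bar>a u p\<bar> \<le> B" by (auto simp: adm_def)
  have "lik (a u) y \<le> exp (\<Sum>p\<in>I. B * \<bar>y p\<bar> / \<sigma>\<^sup>2)" for u
    unfolding lik_def exp_le_cancel_iff
  proof (rule sum_mono)
    fix p assume p: "p \<in> I"
    have "a u p * y p \<le> B * \<bar>y p\<bar>"
      using mult_right_mono[OF B[OF p, of u], of "\<bar>y p\<bar>"] by (simp add: abs_mult[symmetric])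
    hence "a u p * y p / \<sigma>\<^sup>2 \<le> B * \<bar>y p\<bar> / \<sigma>\<^sup>2" by (rule divide_right_mono) simp
    thus "a u p * y p / \<sigma>\<^sup>2 - (a u p)\<^sup>2 / (2 * \<sigma>\<^sup>2) \<le> B * \<bar>y p\<bar> / \<sigma>\<^sup>2"
      using zero_le_power2[of "a u p"] by (smt (verit) divide_nonneg_nonneg zero_le_power2)
  qed
  thus ?thesis by blast
qed

lemma integrable_lik: assumes "adm a" shows "integrable U (\<lambda>u. lik (a u) y)"
proof -
  obtain B where "\<And>u. lik (a u) y \<le> B" using lik_bounded[OF assms] by blast
  thus ?thesis
    by (intro integrable_const_bound[where B=B] lik_measurable1 assms) (auto simp: less_imp_le)
qed

lemma ennreal_mix: "adm a \<Longrightarrow> ennreal (mix a y) = (\<integral>\<^sup>+u. ennreal (lik (a u) y) \<partial>U)"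
  unfolding mix_def by (intro nn_integral_eq_integral[symmetric] integrable_lik) (auto simp: less_imp_le)

lemma mix_measurable: assumes "adm a" shows "mix a \<in> borel_measurable Q"
proof -
  note [measurable] = adm_measurable[OF assms]
  show ?thesis unfolding mix_def[abs_def] lik_def by measurable
qed

lemma mix_pos: assumes "adm a" shows "0 < mix a y"
proof -
  have "0 \<le> mix a y" unfolding mix_def by (intro integral_nonneg_AE) (auto simp: less_imp_le)
  moreover have "mix a y \<noteq> 0"
  proof
    assume "mix a y = 0"
    hence "AE u in U. lik (a u) y = 0"
      unfolding mix_def using integrable_lik[OF assms]
      by (subst (asm) integral_nonneg_eq_0_iff_AE) (auto simp: less_imp_le)
    hence "AE u in U. False" by eventually_elim (use lik_pos in \<open>simp add: less_le\<close>)
    thus False by simp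
  qed
  ultimately show ?thesis by simp
qed

text \<open>Each mixture gets its own independent copy of the latent variable, and y is integrated
  first by means of \<open>lik_mult\<close>. Only an expectation over two latent variables
  remains.\<close>

lemma nn_integral_mix_mult:
  assumes "adm a" "adm b"
  shows "(\<integral>\<^sup>+y. ennreal (mix a y * mix b y) \<partial>Q)
    = (\<integral>\<^sup>+u. \<integral>\<^sup>+v. ennreal (exp (ip (a u) (b v) / \<sigma>\<^sup>2)) \<partial>U \<partial>U)"
proof -
  note m[measurable] = lik_measurable_pair[OF assms(1)] lik_measurable_pair[OF assms(2)]
     mix_measurable[OF assms(2)] lik_measurable1[OF assms(1)] lik_measurable1[OF assms(2)]
     adm_measurable[OF assms(1)] adm_measurable[OF assms(2)]
  have "(\<integral>\<^sup>+y. ennreal (mix a y * mix b y) \<partial>Q)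
      = (\<integral>\<^sup>+y. \<integral>\<^sup>+u. ennreal (lik (a u) y) * ennreal (mix b y) \<partial>U \<partial>Q)"
    using mix_pos[OF assms(1)] mix_pos[OF assms(2)]
    by (simp add: ennreal_mult less_imp_le ennreal_mix[OF assms(1)] nn_integral_multc)
  also have "\<dots> = (\<integral>\<^sup>+u. \<integral>\<^sup>+y. ennreal (lik (a u) y) * ennreal (mix b y) \<partial>Q \<partial>U)"
    by (rule QU.Fubini') measurable
  also have "\<dots> = (\<integral>\<^sup>+u. \<integral>\<^sup>+v. \<integral>\<^sup>+y. ennreal (lik (a u) y) * ennreal (lik (b v) y) \<partial>Q \<partial>U \<partial>U)"
  proof (rule nn_integral_cong)
    fix u
    have "(\<integral>\<^sup>+y. ennreal (lik (a u) y) * ennreal (mix b y) \<partial>Q)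
       = (\<integral>\<^sup>+y. \<integral>\<^sup>+v. ennreal (lik (a u) y) * ennreal (lik (b v) y) \<partial>U \<partial>Q)"
      by (simp add: ennreal_mix[OF assms(2)] nn_integral_cmult)
    also have "\<dots> = (\<integral>\<^sup>+v. \<integral>\<^sup>+y. ennreal (lik (a u) y) * ennreal (lik (b v) y) \<partial>Q \<partial>U)"
      by (rule QU.Fubini') measurable
    finally show "(\<integral>\<^sup>+y. ennreal (lik (a u) y) * ennreal (mix b y) \<partial>Q) = \<dots>" .
  qed
  also have "\<dots> = (\<integral>\<^sup>+u. \<integral>\<^sup>+v. ennreal (exp (ip (a u) (b v) / \<sigma>\<^sup>2)) \<partial>U \<partial>U)"
    by (intro nn_integral_cong)
       (simp add: ennreal_mult'[symmetric] lik_mult less_imp_le,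
        simp add: ennreal_mult' nn_integral_cmult nn_integral_lik)
  finally show ?thesis .
qed

lemma nn_integral_mix: assumes "adm a" shows "(\<integral>\<^sup>+y. ennreal (mix a y) \<partial>Q) = 1"
proof -
  note [measurable] = lik_measurable_pair[OF assms]
  have "(\<integral>\<^sup>+y. ennreal (mix a y) \<partial>Q) = (\<integral>\<^sup>+u. \<integral>\<^sup>+y. ennreal (lik (a u) y) \<partial>Q \<partial>U)"
    unfolding ennreal_mix[OF assms] by (rule QU.Fubini') measurable
  thus ?thesis by (simp add: nn_integral_lik emeasure_space_1)
qed

(* Cauchy-Schwarz, in the form x^2 / w >= 2 c x - c^2 w with c the ratio of the mixtures. *)
lemma mix_square_div_le:
  assumes "adm a" "adm b"
  shows "ennreal ((mix b y)\<^sup>2 / mix a y) \<le> (\<integral>\<^sup>+u. ennreal ((lik (b u) y)\<^sup>2 / lik (a u) y) \<partial>U)"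
proof -
  note [measurable] = lik_measurable1[OF assms(1)] lik_measurable1[OF assms(2)]
  define c where "c = mix b y / mix a y"
  have ap: "0 < mix a y" and bp: "0 < mix b y" using assms mix_pos by auto
  have i: "integrable U (\<lambda>u. 2 * c * lik (b u) y - c\<^sup>2 * lik (a u) y)"
    using integrable_lik[OF assms(1), of y] integrable_lik[OF assms(2), of y] by auto
  have "(mix b y)\<^sup>2 / mix a y = 2 * c * mix b y - c\<^sup>2 * mix a y"
    using ap by (simp add: c_def field_simps power2_eq_square)
  also have "\<dots> = expectation (\<lambda>u. 2 * c * lik (b u) y - c\<^sup>2 * lik (a u) y)"
    using integrable_lik[OF assms(1), of y] integrable_lik[OF assms(2), of y] by (simp add: mix_def)
  finally have "ennreal ((mix b y)\<^sup>2 / mix a y)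
      = ennreal (expectation (\<lambda>u. 2 * c * lik (b u) y - c\<^sup>2 * lik (a u) y))" by simp
  also have "\<dots> \<le> (\<integral>\<^sup>+u. ennreal (2 * c * lik (b u) y - c\<^sup>2 * lik (a u) y) \<partial>U)"
  proof -
    let ?h = "\<lambda>u. 2 * c * lik (b u) y - c\<^sup>2 * lik (a u) y"
    \<comment> \<open>The integrand may be negative, where \<open>ennreal\<close> truncates it to 0;
      hence the passage through its positive part.\<close>
    have "expectation ?h \<le> expectation (\<lambda>u. max 0 (?h u))"
      using i by (intro integral_mono) auto
    hence "ennreal (expectation ?h) \<le> ennreal (expectation (\<lambda>u. max 0 (?h u)))"
      by (rule ennreal_leI)
    also have "\<dots> = (\<integral>\<^sup>+u. ennreal (max 0 (?h u)) \<partial>U)"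
      using i by (intro nn_integral_eq_integral[symmetric]) auto
    also have "\<dots> = (\<integral>\<^sup>+u. ennreal (?h u) \<partial>U)"
      by (intro nn_integral_cong) (simp add: max_def ennreal_neg)
    finally show ?thesis .
  qed
  also have "\<dots> \<le> (\<integral>\<^sup>+u. ennreal ((lik (b u) y)\<^sup>2 / lik (a u) y) \<partial>U)"
    by (intro nn_integral_mono ennreal_leI tangent_le_square_div lik_pos)
  finally show ?thesis .
qed

text \<open>Data processing: with the same u in both mixtures, the divergence is at most that of the
  pairs (u, y). The integral on the left is 1 plus the chi-square divergence, here and
  below.\<close>

lemma chi_square_coupling:
  assumes "adm a" "adm b" and d: "\<And>u. (\<Sum>p\<in>I. (b u p - a u p)\<^sup>2) = d"
  shows "(\<integral>\<^sup>+y. ennreal ((mix b y)\<^sup>2 / mix a y) \<partial>Q) \<le> ennreal (exp (d / \<sigma>\<^sup>2))"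
proof -
  note [measurable] = lik_measurable_pair[OF assms(1)] lik_measurable_pair[OF assms(2)]
  have "(\<integral>\<^sup>+y. ennreal ((mix b y)\<^sup>2 / mix a y) \<partial>Q)
      \<le> (\<integral>\<^sup>+y. \<integral>\<^sup>+u. ennreal ((lik (b u) y)\<^sup>2 / lik (a u) y) \<partial>U \<partial>Q)"
    by (intro nn_integral_mono mix_square_div_le assms)
  also have "\<dots> = (\<integral>\<^sup>+u. \<integral>\<^sup>+y. ennreal ((lik (b u) y)\<^sup>2 / lik (a u) y) \<partial>Q \<partial>U)"
    by (rule QU.Fubini') measurable
  also have "\<dots> = ennreal (exp (d / \<sigma>\<^sup>2))"
    by (simp add: lik_square_div d ennreal_mult' nn_integral_cmult nn_integral_lik emeasure_space_1)
  finally show ?thesis .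
qed

text \<open>As the norm of \<open>a u\<close> is constant, the likelihood is a constant times the
  exponential of a linear functional of \<open>a u\<close>. This functional has mean 0, so exp z
  \<ge> 1 + z suffices, and the bound holds for every y.\<close>

lemma mix_lower_bound:
  assumes "adm a" and c: "\<And>u. (\<Sum>p\<in>I. (a u p)\<^sup>2) = d"
    and m: "\<And>p. p \<in> I \<Longrightarrow> expectation (\<lambda>u. a u p) = 0"
  shows "exp (- d / (2 * \<sigma>\<^sup>2)) \<le> mix a y"
proof -
  note [measurable] = lik_measurable1[OF assms(1)]
  obtain B where B: "\<And>u p. p \<in> I \<Longrightarrow> \<bar>a u p\<bar> \<le> B" using assms(1) by (auto simp: adm_def)
  have ia: "integrable U (\<lambda>u. a u p)" if "p \<in> I" for p
    by (rule integrable_const_bound[where B=B]) (use that B adm_measurable[OF assms(1)] in auto)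
  have i: "integrable U (\<lambda>u. 1 + (\<Sum>p\<in>I. a u p * (y p / \<sigma>\<^sup>2)))"
    by (intro Bochner_Integration.integrable_add Bochner_Integration.integrable_sum integrable_mult_left ia) auto
  have lik: "lik (a u) y = exp (- d / (2 * \<sigma>\<^sup>2)) * exp (\<Sum>p\<in>I. a u p * (y p / \<sigma>\<^sup>2))" for u
    unfolding lik_def exp_add[symmetric] c[of u, symmetric]
    by (simp add: sum_subtractf sum_divide_distrib)
  have "1 = expectation (\<lambda>u. 1 + (\<Sum>p\<in>I. a u p * (y p / \<sigma>\<^sup>2)))"
    using ia m by (simp add: Bochner_Integration.integral_add Bochner_Integration.integral_sum prob_space)
  hence "exp (- d / (2 * \<sigma>\<^sup>2)) = expectation (\<lambda>u. exp (- d / (2 * \<sigma>\<^sup>2)) * (1 + (\<Sum>p\<in>I. a u p * (y p / \<sigma>\<^sup>2))))"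
    by simp
  also have "\<dots> \<le> mix a y"
    unfolding mix_def
    by (intro integral_mono integrable_lik assms integrable_mult_right i, unfold lik)
       (intro mult_left_mono exp_ge_add_one_self, auto)
  finally show ?thesis .
qed

section \<open>Laws of one observation and of the sample, and chi-square bounds\<close>

lemma distr_observation:
  assumes "adm a"
  shows "distr (U \<Otimes>\<^sub>M PiM I (\<lambda>_. std_normal_distribution)) (PiM I (\<lambda>_. borel))
      (\<lambda>(u, e). \<lambda>p\<in>I. a u p + \<sigma> * e p) = density Q (\<lambda>y. ennreal (mix a y))"
    (is "distr (U \<Otimes>\<^sub>M ?G) ?B ?F = _")
proof (rule measure_eqI)
  note [measurable] = adm_measurable[OF assms] lik_measurable_pair[OF assms] mix_measurable[OF assms]
    lik_measurable1[OF assms]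
  interpret G: prob_space ?G
    by (intro prob_space_PiM prob_space_normal_density) simp
  have F[measurable]: "?F \<in> measurable (U \<Otimes>\<^sub>M ?G) ?B"
    unfolding split_beta' by (intro measurable_restrict) measurable
  show "sets (distr (U \<Otimes>\<^sub>M ?G) ?B ?F) = sets (density Q (\<lambda>y. ennreal (mix a y)))"
    by (simp add: sets_Q)
  fix A assume "A \<in> sets (distr (U \<Otimes>\<^sub>M ?G) ?B ?F)"
  hence A[measurable]: "A \<in> sets ?B" by simp
  have AQ[measurable]: "A \<in> sets Q" using A by (simp add: sets_Q)
  have "emeasure (distr (U \<Otimes>\<^sub>M ?G) ?B ?F) A = (\<integral>\<^sup>+w. indicator A (?F w) \<partial>(U \<Otimes>\<^sub>M ?G))"
    by (subst nn_integral_distr[symmetric, OF F]) (auto simp: nn_integral_indicator)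
  also have "\<dots> = (\<integral>\<^sup>+u. \<integral>\<^sup>+e. indicator A (?F (u, e)) \<partial>?G \<partial>U)"
    by (subst G.nn_integral_fst[symmetric]) (auto simp: split_beta')
  also have "\<dots> = (\<integral>\<^sup>+u. \<integral>\<^sup>+y. ennreal (lik (a u) y) * indicator A y \<partial>Q \<partial>U)"
  proof (rule nn_integral_cong)
    fix u
    have m: "(\<lambda>e. \<lambda>p\<in>I. a u p + \<sigma> * e p) \<in> measurable ?G ?B"
      by (intro measurable_restrict) measurable
    have "(\<integral>\<^sup>+e. indicator A (?F (u, e)) \<partial>?G) = emeasure (distr ?G ?B (\<lambda>e. \<lambda>p\<in>I. a u p + \<sigma> * e p)) A"
    proof -
      have "emeasure (distr ?G ?B (\<lambda>e. \<lambda>p\<in>I. a u p + \<sigma> * e p)) A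
          = (\<integral>\<^sup>+y. indicator A y \<partial>distr ?G ?B (\<lambda>e. \<lambda>p\<in>I. a u p + \<sigma> * e p))"
        by (rule nn_integral_indicator[symmetric]) simp
      also have "\<dots> = (\<integral>\<^sup>+e. indicator A (\<lambda>p\<in>I. a u p + \<sigma> * e p) \<partial>?G)"
        by (rule nn_integral_distr[OF m]) measurable
      finally show ?thesis by simp
    qed
    also have "\<dots> = (\<integral>\<^sup>+y. ennreal (lik (a u) y) * indicator A y \<partial>Q)"
      unfolding distr_noise by (rule emeasure_density) auto
    finally show "(\<integral>\<^sup>+e. indicator A (?F (u, e)) \<partial>?G) = \<dots>" .
  qed
  also have "\<dots> = (\<integral>\<^sup>+y. \<integral>\<^sup>+u. ennreal (lik (a u) y) * indicator A y \<partial>U \<partial>Q)"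
    by (rule QU.Fubini'[symmetric]) measurable
  also have "\<dots> = (\<integral>\<^sup>+y. ennreal (mix a y) * indicator A y \<partial>Q)"
    by (simp add: ennreal_mix[OF assms] nn_integral_multc)
  also have "\<dots> = emeasure (density Q (\<lambda>y. ennreal (mix a y))) A"
    by (rule emeasure_density[symmetric]) auto
  finally show "emeasure (distr (U \<Otimes>\<^sub>M ?G) ?B ?F) A = \<dots>" .
qed

lemma distr_sample:
  assumes "adm a" "finite J"
  shows "distr (PiM J (\<lambda>_. U \<Otimes>\<^sub>M PiM I (\<lambda>_. std_normal_distribution))) (PiM J (\<lambda>_. PiM I (\<lambda>_. borel)))
      (\<lambda>\<omega>. \<lambda>j\<in>J. \<lambda>p\<in>I. a (fst (\<omega> j)) p + \<sigma> * snd (\<omega> j) p)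
    = density (PiM J (\<lambda>_. Q)) (\<lambda>y. \<Prod>j\<in>J. ennreal (mix a (y j)))"
proof -
  note [measurable] = adm_measurable[OF assms(1)] mix_measurable[OF assms(1)]
  let ?G = "PiM I (\<lambda>_. std_normal_distribution)" and ?B = "PiM I (\<lambda>_. borel)"
  let ?F = "\<lambda>(u, e). \<lambda>p\<in>I. a u p + \<sigma> * e p"
  interpret G: prob_space ?G
    by (intro prob_space_PiM prob_space_normal_density) simp
  interpret UG: pair_prob_space U ?G ..
  have F: "?F \<in> measurable (U \<Otimes>\<^sub>M ?G) ?B"
    unfolding split_beta' by (intro measurable_restrict) measurable
  have "distr (PiM J (\<lambda>_. U \<Otimes>\<^sub>M ?G)) (PiM J (\<lambda>_. ?B)) (\<lambda>\<omega>. \<lambda>j\<in>J. ?F (\<omega> j))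
     = PiM J (\<lambda>_. distr (U \<Otimes>\<^sub>M ?G) ?B ?F)"
    by (rule distr_PiM_componentwise[OF \<open>finite J\<close> UG.P.prob_space_axioms F])
  also have "\<dots> = PiM J (\<lambda>_. density Q (\<lambda>y. ennreal (mix a y)))"
    by (simp only: distr_observation[OF assms(1)])
  also have "\<dots> = density (PiM J (\<lambda>_. Q)) (\<lambda>y. \<Prod>j\<in>J. ennreal (mix a (y j)))"
  proof (rule PiM_density[OF \<open>finite J\<close> prob_space_Q])
    show "prob_space (density Q (\<lambda>y. ennreal (mix a y)))"
      unfolding distr_observation[OF assms(1), symmetric]
      by (rule UG.P.prob_space_distr[OF F])
  qed simp
  finally show ?thesis by (simp add: split_beta')
qed

text \<open>This is the inner product of the two mixtures in L^2 of \<open>Q\<close>, see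
  \<open>has_integral_mix_mult\<close>. It is real-valued so that overlaps can be
  subtracted.\<close>

definition overlap :: "('u \<Rightarrow> 'i \<Rightarrow> real) \<Rightarrow> ('u \<Rightarrow> 'i \<Rightarrow> real) \<Rightarrow> real" where
  "overlap a b = integral\<^sup>L (U \<Otimes>\<^sub>M U) (\<lambda>w. exp (ip (a (fst w)) (b (snd w)) / \<sigma>\<^sup>2))"

lemma has_integral_mix_mult:
  assumes "adm a" "adm b"
  shows "has_bochner_integral Q (\<lambda>y. mix a y * mix b y) (overlap a b)"
proof -
  note [measurable] = adm_measurable[OF assms(1)] adm_measurable[OF assms(2)]
    mix_measurable[OF assms(1)] mix_measurable[OF assms(2)]
  obtain A where A: "\<And>u p. p \<in> I \<Longrightarrow> \<bar>a u p\<bar> \<le> A" using assms(1) by (auto simp: adm_def)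
  obtain B where B: "\<And>u p. p \<in> I \<Longrightarrow> \<bar>b u p\<bar> \<le> B" using assms(2) by (auto simp: adm_def)
  have bd: "ip (a u) (b v) \<le> (\<Sum>p\<in>I. A * B)" for u v
    unfolding ip_def
  proof (rule sum_mono)
    fix p assume p: "p \<in> I"
    have "\<bar>a u p * b v p\<bar> \<le> A * B"
      unfolding abs_mult using A[OF p] B[OF p]
      by (intro mult_mono) (auto intro: order_trans[OF abs_ge_zero A[OF p]])
    thus "a u p * b v p \<le> A * B" by simp
  qed
  have m[measurable]: "(\<lambda>w. exp (ip (a (fst w)) (b (snd w)) / \<sigma>\<^sup>2)) \<in> borel_measurable (U \<Otimes>\<^sub>M U)"
    unfolding ip_def by measurable
  have i: "integrable (U \<Otimes>\<^sub>M U) (\<lambda>w. exp (ip (a (fst w)) (b (snd w)) / \<sigma>\<^sup>2))"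
    by (rule UU.P.integrable_const_bound[where B="exp ((\<Sum>p\<in>I. A * B) / \<sigma>\<^sup>2)"])
       (use bd in \<open>auto intro!: divide_right_mono simp del: sum_constant\<close>)
  have pos: "0 \<le> overlap a b" unfolding overlap_def by (intro integral_nonneg_AE) auto
  have "(\<integral>\<^sup>+y. ennreal (mix a y * mix b y) \<partial>Q)
      = (\<integral>\<^sup>+w. ennreal (exp (ip (a (fst w)) (b (snd w)) / \<sigma>\<^sup>2)) \<partial>(U \<Otimes>\<^sub>M U))"
    unfolding nn_integral_mix_mult[OF assms] by (subst nn_integral_fst[symmetric]) auto
  also have "\<dots> = ennreal (overlap a b)"
    unfolding overlap_def by (rule nn_integral_eq_integral[OF i]) auto
  finally show ?thesis
    using pos mix_pos[OF assms(1)] mix_pos[OF assms(2)]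
    by (intro has_bochner_integral_nn_integral) (auto simp: less_imp_le)
qed

lemma has_integral_mix: "adm a \<Longrightarrow> has_bochner_integral Q (mix a) 1"
  using mix_measurable mix_pos nn_integral_mix
  by (intro has_bochner_integral_nn_integral) (auto simp: less_imp_le)

text \<open>For densities p and q one has q^2 / p = (q - p)^2 / p + 2 q - p, and 2 q - p integrates
  to 1. Replacing 1 / p by its upper bound from \<open>mix_lower_bound\<close> leaves the squared
  L^2 distance, which is a combination of overlaps.\<close>

lemma chi_square_overlap:
  assumes "adm a" "adm b" and d: "\<And>u. (\<Sum>p\<in>I. (a u p)\<^sup>2) = d"
    and m: "\<And>p. p \<in> I \<Longrightarrow> expectation (\<lambda>u. a u p) = 0"
  shows "(\<integral>\<^sup>+y. ennreal ((mix b y)\<^sup>2 / mix a y) \<partial>Q)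
    \<le> ennreal (1 + exp (d / (2 * \<sigma>\<^sup>2)) * (overlap a a + overlap b b - 2 * overlap a b))"
proof -
  let ?e = "exp (d / (2 * \<sigma>\<^sup>2))"
  let ?h = "\<lambda>y. ?e * (mix a y * mix a y + mix b y * mix b y - 2 * (mix a y * mix b y)) + (2 * mix b y - mix a y)"
  have le: "(mix b y)\<^sup>2 / mix a y \<le> ?h y" for y
  proof -
    have p: "0 < mix a y" by (rule mix_pos[OF assms(1)])
    have "1 \<le> ?e * mix a y"
      using mult_left_mono[OF mix_lower_bound[OF assms(1) d m, of y], of ?e]
      by (simp add: exp_add[symmetric])
    hence "(mix b y - mix a y)\<^sup>2 * 1 \<le> (mix b y - mix a y)\<^sup>2 * (?e * mix a y)"
      by (intro mult_left_mono) auto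
    hence "(mix b y)\<^sup>2 \<le> ?h y * mix a y"
      by (simp add: power2_eq_square algebra_simps)
    thus ?thesis using p by (simp add: pos_divide_le_eq)
  qed
  have hb: "has_bochner_integral Q ?h (?e * (overlap a a + overlap b b - 2 * overlap a b) + (2 * 1 - 1))"
    by (intro has_bochner_integral_add has_bochner_integral_diff has_bochner_integral_mult_right
        has_integral_mix_mult has_integral_mix assms)
  have "(\<integral>\<^sup>+y. ennreal ((mix b y)\<^sup>2 / mix a y) \<partial>Q) \<le> (\<integral>\<^sup>+y. ennreal (?h y) \<partial>Q)"
    by (intro nn_integral_mono ennreal_leI le)
  also have "\<dots> = ennreal (integral\<^sup>L Q ?h)"
    using hb le mix_pos[OF assms(1)] mix_pos[OF assms(2)]
    by (intro nn_integral_eq_integral) (auto simp: has_bochner_integral_iff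
        intro!: order_trans[OF _ le] divide_nonneg_pos)
  also have "integral\<^sup>L Q ?h = 1 + ?e * (overlap a a + overlap b b - 2 * overlap a b)"
    using hb by (simp add: has_bochner_integral_iff)
  finally show ?thesis .
qed

(* Le Cam's two-point bound: min p q >= q - q^2 / (4 p) for the product densities p and q. *)
lemma two_point_bound:
  fixes J :: "'j set"
  assumes "adm a" "adm b" "finite J"
    and \<rho>: "(\<integral>\<^sup>+y. ennreal ((mix b y)\<^sup>2 / mix a y) \<partial>Q) \<le> ennreal \<rho>" "0 \<le> \<rho>" "\<rho> ^ card J \<le> 2"
    and H[measurable]: "H \<in> borel_measurable (PiM J (\<lambda>_. Q))" "H' \<in> borel_measurable (PiM J (\<lambda>_. Q))"
    and H0: "\<And>y. 0 \<le> H y" "\<And>y. 0 \<le> H' y" and s: "\<And>y. s \<le> H y + H' y"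
  shows "ennreal (s / 2) \<le> (\<integral>\<^sup>+y. (\<Prod>j\<in>J. ennreal (mix a (y j))) * ennreal (H y) \<partial>PiM J (\<lambda>_. Q))
      + (\<integral>\<^sup>+y. (\<Prod>j\<in>J. ennreal (mix b (y j))) * ennreal (H' y) \<partial>PiM J (\<lambda>_. Q))"
proof (cases "0 \<le> s")
  case True
  let ?QJ = "PiM J (\<lambda>_. Q)"
  note [measurable] = mix_measurable[OF assms(1)] mix_measurable[OF assms(2)]
  interpret P: product_prob_space "\<lambda>_. Q" J by (rule product_prob_spaceI) (rule prob_space_Q)
  define p where "p y = (\<Prod>j\<in>J. mix a (y j))" for y
  define q where "q y = (\<Prod>j\<in>J. mix b (y j))" for y
  have [measurable]: "p \<in> borel_measurable ?QJ" "q \<in> borel_measurable ?QJ"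
    unfolding p_def[abs_def] q_def[abs_def] by measurable
  have pos: "0 < p y" "0 < q y" for y
    unfolding p_def q_def by (intro prod_pos mix_pos assms)+
  have pe: "(\<Prod>j\<in>J. ennreal (mix a (y j))) = ennreal (p y)" "(\<Prod>j\<in>J. ennreal (mix b (y j))) = ennreal (q y)" for y
    unfolding p_def q_def using mix_pos[OF assms(1)] mix_pos[OF assms(2)]
    by (auto intro!: prod_ennreal simp: less_imp_le)
  have q1: "(\<integral>\<^sup>+y. ennreal (q y) \<partial>?QJ) = 1"
    unfolding pe(2)[symmetric]
    by (subst P.product_nn_integral_prod[OF \<open>finite J\<close>, of "\<lambda>_ y. ennreal (mix b y)"])
       (auto simp: nn_integral_mix[OF assms(2)])
  have "(\<integral>\<^sup>+y. ennreal ((q y)\<^sup>2 / p y) \<partial>?QJ)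
      = (\<integral>\<^sup>+y. (\<Prod>j\<in>J. ennreal ((mix b (y j))\<^sup>2 / mix a (y j))) \<partial>?QJ)"
    using mix_pos[OF assms(1)] unfolding p_def q_def
    by (intro nn_integral_cong, subst prod_ennreal)
       (auto simp: less_imp_le prod_dividef prod_power_distrib)
  \<comment> \<open>1 plus the chi-square divergence is multiplicative over independent
    observations.\<close>
  also have "\<dots> = (\<Prod>j\<in>J. \<integral>\<^sup>+y. ennreal ((mix b y)\<^sup>2 / mix a y) \<partial>Q)"
    using \<open>finite J\<close> by (subst P.product_nn_integral_prod) auto
  also have "\<dots> \<le> ennreal \<rho> ^ card J"
    using \<rho>(1) by (simp add: power_mono)
  also have "\<dots> \<le> ennreal 2"
    unfolding ennreal_power[OF \<rho>(2)] by (rule ennreal_leI[OF \<rho>(3)])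
  finally have qp: "(\<integral>\<^sup>+y. ennreal ((q y)\<^sup>2 / p y) \<partial>?QJ) \<le> ennreal 2" .
  have "1 = (\<integral>\<^sup>+y. ennreal (q y) \<partial>?QJ)" by (simp add: q1)
  also have "\<dots> \<le> (\<integral>\<^sup>+y. ennreal (min (p y) (q y)) + ennreal (1/4) * ennreal ((q y)\<^sup>2 / p y) \<partial>?QJ)"
  proof (rule nn_integral_mono)
    fix y
    have "q y \<le> min (p y) (q y) + 1/4 * ((q y)\<^sup>2 / p y)"
    proof (cases "p y \<le> q y")
      case True
      have "0 \<le> (2 * p y - q y)\<^sup>2" by simp
      hence "q y * (4 * p y) \<le> p y * (4 * p y) + (q y)\<^sup>2"
        by (simp add: power2_eq_square algebra_simps)
      thus ?thesis using True pos[of y] by (simp add: field_simps)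
    next
      case False
      thus ?thesis using pos[of y] by (simp add: min_def)
    qed
    hence "ennreal (q y) \<le> ennreal (min (p y) (q y) + 1/4 * ((q y)\<^sup>2 / p y))" by (rule ennreal_leI)
    also have "\<dots> = ennreal (min (p y) (q y)) + ennreal (1/4) * ennreal ((q y)\<^sup>2 / p y)"
      using pos[of y] by (subst ennreal_plus) (auto simp: ennreal_mult'[symmetric] less_imp_le)
    finally show "ennreal (q y) \<le> \<dots>" .
  qed
  \<comment> \<open>The origin of the threshold 2 on \<open>\<rho> ^ card J\<close>: the minimum of
    the densities has integral at least 1 - 2/4 = 1/2.\<close>
  also have "\<dots> = (\<integral>\<^sup>+y. ennreal (min (p y) (q y)) \<partial>?QJ) + ennreal (1/4) * (\<integral>\<^sup>+y. ennreal ((q y)\<^sup>2 / p y) \<partial>?QJ)"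
    by (subst nn_integral_add) (auto simp: nn_integral_cmult)
  also have "\<dots> \<le> (\<integral>\<^sup>+y. ennreal (min (p y) (q y)) \<partial>?QJ) + ennreal (1/4) * ennreal 2"
    by (intro add_left_mono mult_left_mono qp) auto
  also have "ennreal (1/4) * ennreal 2 = ennreal (1/2)"
    by (subst ennreal_mult'[symmetric]) (auto simp del: ennreal_numeral intro!: arg_cong[of _ _ ennreal])
  finally have one: "1 \<le> (\<integral>\<^sup>+y. ennreal (min (p y) (q y)) \<partial>?QJ) + ennreal (1/2)" .
  have half: "ennreal (1/2) \<le> (\<integral>\<^sup>+y. ennreal (min (p y) (q y)) \<partial>?QJ)"
  proof (cases "(\<integral>\<^sup>+y. ennreal (min (p y) (q y)) \<partial>?QJ)")
    case (real x)
    have "ennreal 1 \<le> ennreal (x + 1/2)"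
      using one unfolding real(2) using real(1) by (simp add: ennreal_plus)
    hence "1 / 2 \<le> x" using real(1) by (subst (asm) ennreal_le_iff) auto
    thus ?thesis unfolding real(2) by (rule ennreal_leI)
  qed simp
  have "ennreal (s / 2) = ennreal s * ennreal (1/2)"
    using True by (subst ennreal_mult'[symmetric]) auto
  also have "\<dots> \<le> ennreal s * (\<integral>\<^sup>+y. ennreal (min (p y) (q y)) \<partial>?QJ)"
    by (intro mult_left_mono half) auto
  also have "\<dots> = (\<integral>\<^sup>+y. ennreal s * ennreal (min (p y) (q y)) \<partial>?QJ)"
    by (rule nn_integral_cmult[symmetric]) measurable
  also have "\<dots> \<le> (\<integral>\<^sup>+y. ennreal (p y) * ennreal (H y) + ennreal (q y) * ennreal (H' y) \<partial>?QJ)"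
  proof (rule nn_integral_mono)
    fix y
    have "s * min (p y) (q y) \<le> (H y + H' y) * min (p y) (q y)"
      using s[of y] pos[of y] by (intro mult_right_mono) auto
    also have "\<dots> \<le> p y * H y + q y * H' y"
      using H0[of y] mult_right_mono[of "min (p y) (q y)" "p y" "H y"]
        mult_right_mono[of "min (p y) (q y)" "q y" "H' y"] by (simp add: algebra_simps)
    finally have "ennreal (s * min (p y) (q y)) \<le> ennreal (p y * H y + q y * H' y)" by (rule ennreal_leI)
    thus "ennreal s * ennreal (min (p y) (q y)) \<le> ennreal (p y) * ennreal (H y) + ennreal (q y) * ennreal (H' y)"
      using True pos[of y] H0[of y] by (simp add: ennreal_mult'[symmetric] ennreal_plus[symmetric] less_imp_le del: ennreal_plus)
  qed
  also have "\<dots> = (\<integral>\<^sup>+y. ennreal (p y) * ennreal (H y) \<partial>?QJ) + (\<integral>\<^sup>+y. ennreal (q y) * ennreal (H' y) \<partial>?QJ)"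
    by (rule nn_integral_add) measurable
  finally show ?thesis unfolding pe .
qed (simp add: ennreal_neg)

end

section \<open>Mixtures over rotations\<close>

abbreviation unif :: "real measure" where
  "unif \<equiv> uniform_measure lborel {-pi..<pi}"

lemma prob_space_unif: "prob_space unif"
  by (rule prob_space_uniform_measure) auto

text \<open>The right endpoint is a null set; the closed interval is the form to which the
  fundamental theorem of calculus applies.\<close>

lemma integral_unif:
  assumes [measurable]: "f \<in> borel_measurable borel"
  shows "(LINT x|unif. f x) = (LINT x|lborel. f x * indicator {-pi..pi} x) / (2 * pi)"
proof -
  have "unif = density lborel (\<lambda>x. ennreal (indicator {-pi..<pi} x / (2 * pi)))"
    unfolding uniform_measure_def
    by (intro density_cong) (auto simp: indicator_def divide_ennreal[symmetric] ennreal_1[symmetric] simp del: ennreal_1)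
  hence "(LINT x|unif. f x) = (LINT x|lborel. indicator {-pi..<pi} x / (2 * pi) * f x)"
    by (simp only:) (subst integral_real_density, auto)
  also have "\<dots> = (LINT x|lborel. (f x * indicator {-pi..pi} x) / (2 * pi))"
  proof (rule integral_cong_AE)
    have "AE x in lborel. x \<noteq> pi" by (rule AE_lborel_singleton)
    thus "AE x in lborel. indicator {-pi..<pi} x / (2 * pi) * f x = (f x * indicator {-pi..pi} x) / (2 * pi)"
      by eventually_elim (auto simp: indicator_def)
  qed auto
  finally show ?thesis by simp
qed

lemma integral_unif_cos: "n \<noteq> 0 \<Longrightarrow> (LINT x|unif. cos (of_int n * x)) = 0"
proof -
  assume n: "n \<noteq> 0"
  have "((\<lambda>x. sin (of_int n * x) / of_int n) has_real_derivative cos (of_int n * x)) (at x)" for x :: real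
    using n by (auto intro!: derivative_eq_intros)
  from integral_FTC_Icc_real[OF _ this, of "-pi" pi] show ?thesis
    by (subst integral_unif) (auto simp: sin_times_pi_eq_0 mult.commute)
qed

lemma integral_unif_sin: "(LINT x|unif. sin (of_int n * x)) = 0"
proof (cases "n = 0")
  case False
  have "((\<lambda>x. - cos (of_int n * x) / of_int n) has_real_derivative sin (of_int n * x)) (at x)" for x :: real
    using False by (auto intro!: derivative_eq_intros)
  from integral_FTC_Icc_real[OF _ this, of "-pi" pi] show ?thesis
    by (subst integral_unif) auto
qed simp

text \<open>The difference is not reduced modulo 2 pi, but only integer frequencies are tested. The
  addition theorems split each moment into products over the two independent angles, and the factor
  in the second angle has mean 0. For the sine with n = 0 this fails, as the cosine factor then has
  mean 1, and the moment is 0 trivially.\<close>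

lemma circle_variable_difference:
  "circle_variable (unif \<Otimes>\<^sub>M unif) (\<lambda>w. snd w - fst w)"
proof -
  interpret U: prob_space unif by (rule prob_space_unif)
  interpret UU: pair_prob_space unif unif ..
  have i: "integrable (unif \<Otimes>\<^sub>M unif) (\<lambda>w. f (fst w) * h (snd w))"
    if "f \<in> borel_measurable borel" "h \<in> borel_measurable borel"
      "\<And>x. \<bar>f x\<bar> \<le> 1" "\<And>x. \<bar>h x\<bar> \<le> 1" for f h :: "real \<Rightarrow> real"
  proof (rule UU.P.integrable_const_bound[where B=1])
    show "AE w in unif \<Otimes>\<^sub>M unif. norm (f (fst w) * h (snd w)) \<le> 1"
      using that(3,4) by (auto simp: abs_mult intro!: AE_I2 mult_le_one)
    show "(\<lambda>w. f (fst w) * h (snd w)) \<in> borel_measurable (unif \<Otimes>\<^sub>M unif)"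
      using that(1,2) by measurable
  qed
  have e: "(LINT w|(unif \<Otimes>\<^sub>M unif). f (fst w) * h (snd w)) = 0"
    if "f \<in> borel_measurable borel" "h \<in> borel_measurable borel"
      "\<And>x. \<bar>f x\<bar> \<le> 1" "\<And>x. \<bar>h x\<bar> \<le> 1" "(LINT x|unif. h x) = 0" for f h :: "real \<Rightarrow> real"
    using UU.integral_fst'[OF i[OF that(1-4)]] that(5) by simp
  show ?thesis
  proof
    show "(\<lambda>w. snd w - fst w) \<in> borel_measurable (unif \<Otimes>\<^sub>M unif)" by measurable
  next
    fix n :: int assume n: "n \<noteq> 0"
    have "(LINT w|(unif \<Otimes>\<^sub>M unif). cos (of_int n * (snd w - fst w)))
        = (LINT w|(unif \<Otimes>\<^sub>M unif). cos (of_int n * fst w) * cos (of_int n * snd w)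
            + sin (of_int n * fst w) * sin (of_int n * snd w))"
      by (simp add: right_diff_distrib cos_diff mult.commute)
    also have "\<dots> = (LINT w|(unif \<Otimes>\<^sub>M unif). cos (of_int n * fst w) * cos (of_int n * snd w))
            + (LINT w|(unif \<Otimes>\<^sub>M unif). sin (of_int n * fst w) * sin (of_int n * snd w))"
      by (intro Bochner_Integration.integral_add i) auto
    also have "\<dots> = 0"
      using e[of "\<lambda>x. cos (of_int n * x)" "\<lambda>x. cos (of_int n * x)"]
        e[of "\<lambda>x. sin (of_int n * x)" "\<lambda>x. sin (of_int n * x)"] n
      by (simp add: integral_unif_cos integral_unif_sin)
    finally show "(LINT w|(unif \<Otimes>\<^sub>M unif). cos (of_int n * (snd w - fst w))) = 0" .
  next
    fix n :: int
    show "(LINT w|(unif \<Otimes>\<^sub>M unif). sin (of_int n * (snd w - fst w))) = 0"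
    proof (cases "n = 0")
      case False
      have "(LINT w|(unif \<Otimes>\<^sub>M unif). sin (of_int n * (snd w - fst w)))
          = (LINT w|(unif \<Otimes>\<^sub>M unif). cos (of_int n * fst w) * sin (of_int n * snd w)
              - sin (of_int n * fst w) * cos (of_int n * snd w))"
        by (simp add: right_diff_distrib sin_diff mult.commute)
      also have "\<dots> = (LINT w|(unif \<Otimes>\<^sub>M unif). cos (of_int n * fst w) * sin (of_int n * snd w))
              - (LINT w|(unif \<Otimes>\<^sub>M unif). sin (of_int n * fst w) * cos (of_int n * snd w))"
        by (intro Bochner_Integration.integral_diff i) auto
      also have "\<dots> = 0"
        using e[of "\<lambda>x. cos (of_int n * x)" "\<lambda>x. sin (of_int n * x)"]
          e[of "\<lambda>x. sin (of_int n * x)" "\<lambda>x. cos (of_int n * x)"] False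
        by (simp add: integral_unif_cos integral_unif_sin)
      finally show ?thesis .
    qed simp
  qed
qed

section \<open>The rotation action in complex coordinates\<close>

lemma finite_coords[simp]: "finite (coords K)"
  by (simp add: coords_def)

lemma sum_coords: "(\<Sum>p\<in>coords K. f p) = (\<Sum>k\<in>{1..K}. f (k, 1) + f (k, 2))"
proof -
  have "(\<Sum>p\<in>coords K. f p) = (\<Sum>k\<in>{1..K}. \<Sum>i\<in>{1, 2}. f (k, i))"
    unfolding coords_def by (simp only: sum.cartesian_product case_prod_conv split_def prod.collapse)
  thus ?thesis by simp
qed

lemma g_apply_1:
  assumes "k \<in> {1..K}"
  shows "g_apply K \<alpha> \<theta> (k, 1) = cos (real k * \<alpha>) * \<theta> (k, 1) - sin (real k * \<alpha>) * \<theta> (k, 2)"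
proof -
  have "g_apply K \<alpha> \<theta> (k, 1) = (\<Sum>l\<in>{1..K}. if l = k then
      cos (real k * \<alpha>) * \<theta> (k, 1) - sin (real k * \<alpha>) * \<theta> (k, 2) else 0)"
    using assms unfolding g_apply_def sum_coords
    by (subst restrict_apply', simp add: coords_def, intro sum.cong refl) (auto simp: g_def)
  thus ?thesis using assms by simp
qed

lemma g_apply_2:
  assumes "k \<in> {1..K}"
  shows "g_apply K \<alpha> \<theta> (k, 2) = sin (real k * \<alpha>) * \<theta> (k, 1) + cos (real k * \<alpha>) * \<theta> (k, 2)"
proof -
  have "g_apply K \<alpha> \<theta> (k, 2) = (\<Sum>l\<in>{1..K}. if l = k then
      sin (real k * \<alpha>) * \<theta> (k, 1) + cos (real k * \<alpha>) * \<theta> (k, 2) else 0)"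
    using assms unfolding g_apply_def sum_coords
    by (subst restrict_apply', simp add: coords_def, intro sum.cong refl) (auto simp: g_def)
  thus ?thesis using assms by simp
qed

text \<open>As a complex number, the k-th block is simply multiplied by
  \<open>cis (real k * \<alpha>)\<close> under rotation, so phases and moduli can be handled
  separately.\<close>

definition cz :: "vec \<Rightarrow> nat \<Rightarrow> complex" where
  "cz \<theta> k = Complex (\<theta> (k, 1)) (\<theta> (k, 2))"

lemma cz_g_apply: "k \<in> {1..K} \<Longrightarrow> cz (g_apply K \<alpha> \<theta>) k = cis (real k * \<alpha>) * cz \<theta> k"
  by (simp add: cz_def complex_eq_iff g_apply_1 g_apply_2 del: One_nat_def)

lemma sq_norm_cz: "sq_norm K v = (\<Sum>k\<in>{1..K}. (cmod (cz v k))\<^sup>2)"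
  unfolding sq_norm_def sum_coords by (simp add: cz_def cmod_power2 del: One_nat_def)

lemma sq_norm_diff_g_apply:
  "sq_norm K (\<lambda>p. \<theta> p - g_apply K \<alpha> v p)
    = (\<Sum>k\<in>{1..K}. (cmod (cz \<theta> k - cis (real k * \<alpha>) * cz v k))\<^sup>2)"
  unfolding sq_norm_cz
proof (rule sum.cong[OF refl])
  fix k assume k: "k \<in> {1..K}"
  have "cz (\<lambda>p. \<theta> p - g_apply K \<alpha> v p) k = cz \<theta> k - cz (g_apply K \<alpha> v) k"
    by (simp add: cz_def complex_eq_iff)
  thus "(cmod (cz (\<lambda>p. \<theta> p - g_apply K \<alpha> v p) k))\<^sup>2 = (cmod (cz \<theta> k - cis (real k * \<alpha>) * cz v k))\<^sup>2"
    using k by (simp add: cz_g_apply)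
qed

lemma g_apply_measurable: "(\<lambda>\<alpha>. g_apply K \<alpha> \<theta> p) \<in> borel_measurable borel"
proof (cases "p \<in> coords K")
  case True
  then obtain k i where p: "p = (k, i)" and k: "k \<in> {1..K}" and i: "i = 1 \<or> i = 2"
    by (auto simp: coords_def)
  show ?thesis using i
    by (elim disjE) (simp_all add: p g_apply_1[OF k] g_apply_2[OF k] del: One_nat_def)
qed (simp add: g_apply_def)

lemma g_apply_bound:
  assumes "p \<in> coords K"
  shows "\<bar>g_apply K \<alpha> \<theta> p\<bar> \<le> (\<Sum>q\<in>coords K. \<bar>\<theta> q\<bar>)"
proof -
  have "\<bar>g \<alpha> p q * \<theta> q\<bar> \<le> 1 * \<bar>\<theta> q\<bar>" for q
    unfolding abs_mult
    by (intro mult_right_mono) (auto simp: g_def split: prod.splits)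
  thus ?thesis using assms
    unfolding g_apply_def by (auto intro!: order_trans[OF sum_abs] sum_mono)
qed

text \<open>All frequencies are at least 1, so averaging over rotations annihilates every
  coordinate. This is the centering that \<open>mix_lower_bound\<close> requires.\<close>

lemma integral_g_apply:
  assumes "p \<in> coords K"
  shows "(LINT \<alpha>|unif. g_apply K \<alpha> \<theta> p) = 0"
proof -
  interpret U: prob_space unif by (rule prob_space_unif)
  obtain k i where p: "p = (k, i)" and k: "k \<in> {1..K}" and i: "i = 1 \<or> i = 2"
    using assms by (auto simp: coords_def)
  have ic: "integrable unif (\<lambda>\<alpha>. cos (real k * \<alpha>))" "integrable unif (\<lambda>\<alpha>. sin (real k * \<alpha>))"
    by (auto intro!: U.integrable_const_bound[where B=1])
  have z: "(LINT \<alpha>|unif. cos (real k * \<alpha>)) = 0" "(LINT \<alpha>|unif. sin (real k * \<alpha>)) = 0"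
    using integral_unif_cos[of "int k"] integral_unif_sin[of "int k"] k by auto
  show ?thesis using i ic z
    by (elim disjE) (simp_all add: p g_apply_1[OF k] g_apply_2[OF k] del: One_nat_def)
qed

section \<open>The observations as mixtures over orbits\<close>

locale rotation_model =
  fixes K :: nat and \<sigma> :: real
  assumes sigma_pos: "0 < \<sigma>"
begin

sublocale gaussian_mixture unif "coords K" \<sigma>
proof -
  interpret prob_space unif by (rule prob_space_unif)
  show "gaussian_mixture unif (coords K) \<sigma>"
    by unfold_locales (simp_all add: sigma_pos)
qed

definition orbit :: "vec \<Rightarrow> real \<Rightarrow> vec" where
  "orbit \<theta> \<alpha> = g_apply K \<alpha> \<theta>"

lemma adm_orbit: "adm (orbit \<theta>)"
  unfolding adm_def orbit_def
proof (intro conjI ballI exI allI)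
  show "(\<lambda>u. g_apply K u \<theta> p) \<in> borel_measurable unif" for p
    using g_apply_measurable by simp
qed (rule g_apply_bound)

lemma orbit_sq_norm: "(\<Sum>p\<in>coords K. (orbit \<theta> \<alpha> p)\<^sup>2) = sq_norm K \<theta>"
  using sq_norm_cz[of K "g_apply K \<alpha> \<theta>"]
  by (simp add: orbit_def sq_norm_def[of K "g_apply K \<alpha> \<theta>"] cz_g_apply norm_mult sq_norm_cz[of K \<theta>])

lemma orbit_diff_sq_norm:
  "(\<Sum>p\<in>coords K. (orbit \<theta>' \<alpha> p - orbit \<theta> \<alpha> p)\<^sup>2) = sq_norm K (\<lambda>p. \<theta>' p - \<theta> p)"
proof -
  have "orbit \<theta>' \<alpha> p - orbit \<theta> \<alpha> p = orbit (\<lambda>p. \<theta>' p - \<theta> p) \<alpha> p" if "p \<in> coords K" for p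
    using that by (simp add: orbit_def g_apply_def right_diff_distrib sum_subtractf)
  thus ?thesis using orbit_sq_norm[of "\<lambda>p. \<theta>' p - \<theta> p" \<alpha>] by simp
qed

text \<open>The angles enter only through v - u, and the phases of the two vectors only through
  their difference at each frequency. For equal vectors this is a pure cosine polynomial determined
  by the radii.\<close>

lemma ip_orbit:
  "ip (orbit \<theta> u) (orbit \<theta>' v) = (\<Sum>k\<in>{1..K}.
     Re (cnj (cz \<theta> k) * cz \<theta>' k) * cos (real k * (v - u)) - Im (cnj (cz \<theta> k) * cz \<theta>' k) * sin (real k * (v - u)))"
  unfolding ip_def sum_coords orbit_def
proof (rule sum.cong[OF refl])
  fix k assume k: "k \<in> {1..K}"
  show "g_apply K u \<theta> (k, 1) * g_apply K v \<theta>' (k, 1) + g_apply K u \<theta> (k, 2) * g_apply K v \<theta>' (k, 2)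
    = Re (cnj (cz \<theta> k) * cz \<theta>' k) * cos (real k * (v - u)) - Im (cnj (cz \<theta> k) * cz \<theta>' k) * sin (real k * (v - u))"
    unfolding g_apply_1[OF k] g_apply_2[OF k] right_diff_distrib[of "real k"] cos_diff sin_diff
    by (simp add: cz_def algebra_simps del: One_nat_def)
qed

text \<open>Change of variables to one measure shared by all parameters, the power of
  \<open>Q\<close>, over which the hypotheses can be compared.\<close>

lemma nn_integral_obs:
  assumes [measurable]: "H \<in> borel_measurable (PiM {1..N} (\<lambda>_. vecs K))"
  shows "(\<integral>\<^sup>+\<omega>. H (obs K N \<sigma> \<theta> \<omega>) \<partial>latent K N)
    = (\<integral>\<^sup>+y. (\<Prod>j\<in>{1..N}. ennreal (mix (orbit \<theta>) (y j))) * H y \<partial>PiM {1..N} (\<lambda>_. Q))"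
proof -
  note [measurable] = mix_measurable[OF adm_orbit, of \<theta>]
  have s: "sets (PiM {1..N} (\<lambda>_. vecs K)) = sets (PiM {1..N} (\<lambda>_. Q))"
    by (intro sets_PiM_cong) (auto simp: vecs_def sets_Q)
  have H: "H \<in> borel_measurable (PiM {1..N} (\<lambda>_. Q))"
    using assms measurable_cong_sets[OF s refl, of borel] by blast
  have "(\<integral>\<^sup>+\<omega>. H (obs K N \<sigma> \<theta> \<omega>) \<partial>latent K N)
      = (\<integral>\<^sup>+y. H y \<partial>distr (latent K N) (PiM {1..N} (\<lambda>_. vecs K)) (obs K N \<sigma> \<theta>))"
    by (subst nn_integral_distr[OF obs_measurable]) (use assms in simp_all)
  also have "distr (latent K N) (PiM {1..N} (\<lambda>_. vecs K)) (obs K N \<sigma> \<theta>)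
      = density (PiM {1..N} (\<lambda>_. Q)) (\<lambda>y. \<Prod>j\<in>{1..N}. ennreal (mix (orbit \<theta>) (y j)))"
    using distr_sample[OF adm_orbit, of "{1..N}" \<theta>]
    by (simp add: latent_def obs_def[abs_def] vecs_def orbit_def)
  also have "(\<integral>\<^sup>+y. H y \<partial>\<dots>) = (\<integral>\<^sup>+y. (\<Prod>j\<in>{1..N}. ennreal (mix (orbit \<theta>) (y j))) * H y \<partial>PiM {1..N} (\<lambda>_. Q))"
    by (rule nn_integral_density[OF _ H]) measurable
  finally show ?thesis .
qed

end

section \<open>The hypotheses and their separation\<close>

text \<open>The lower bound on l serves twice: \<open>l div 2\<close> falls outside this set, and
  every higher multiple of l exceeds K.\<close>

definition halves :: "nat \<Rightarrow> nat set" where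
  "halves K = {l \<in> {1..K}. even l \<and> K < 2 * l}"

lemma finite_halves[simp]: "finite (halves K)"
  by (simp add: halves_def)

lemma half_in:
  assumes "l \<in> halves K"
  shows "l div 2 \<in> {1..K}" "l div 2 \<notin> halves K" "l = 2 * (l div 2)" "l \<in> {1..K}"
  using assms by (auto simp: halves_def elim!: evenE)

lemma card_halves:
  assumes "2 \<le> K"
  shows "real K / 6 \<le> real (card (halves K))"
proof -
  have "halves K = (\<lambda>k. 2 * k) ` {K div 4 + 1..K div 2}"
    by (auto simp: halves_def image_iff elim!: evenE)
  hence "card (halves K) = K div 2 - K div 4"
    by (simp add: card_image inj_on_def)
  moreover have "K \<le> 6 * (K div 2 - K div 4)"
  proof (cases "K < 6")
    case True
    hence "K = 2 \<or> K = 3 \<or> K = 4 \<or> K = 5" using assms by auto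
    thus ?thesis by auto
  next
    case False
    \<comment> \<open>The two divisions lose at most 1/2, and 6 (K/4 - 1/2) \<ge> K exactly when K
      \<ge> 6; hence the separate check of smaller K. At K = 5 the set has the single element
      4.\<close>
    have "4 * (K div 4) \<le> K" "K \<le> 2 * (K div 2) + 1" by auto
    thus ?thesis using False by linarith
  qed
  ultimately show ?thesis by linarith
qed

(* Frequency l carries the sign of the hypothesis; frequency l div 2 is fixed and pins down the
   rotation, as cz (l) * cnj (cz (l div 2)) ^ 2 is rotation invariant. *)
definition hyp :: "real \<Rightarrow> nat \<Rightarrow> real \<Rightarrow> nat set \<Rightarrow> vec" where
  "hyp \<beta> K x \<tau> = (\<lambda>(k, i)\<in>coords K.
     if k \<in> halves K then
       (if i = 1 then sqrt ((real k powr (-\<beta>))\<^sup>2 - x\<^sup>2) else if k \<in> \<tau> then x else - x)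
     else if i = 1 then real k powr (-\<beta>) else 0)"

definition flip :: "'a \<Rightarrow> 'a set \<Rightarrow> 'a set" where
  "flip l \<tau> = (if l \<in> \<tau> then \<tau> - {l} else insert l \<tau>)"

lemma flip_flip[simp]: "flip l (flip l \<tau>) = \<tau>"
  by (auto simp: flip_def)

lemma cz_hyp:
  assumes "k \<in> {1..K}"
  shows "cz (hyp \<beta> K x \<tau>) k = (if k \<in> halves K
    then Complex (sqrt ((real k powr (-\<beta>))\<^sup>2 - x\<^sup>2)) (if k \<in> \<tau> then x else - x)
    else of_real (real k powr (-\<beta>)))"
  using assms by (auto simp: cz_def hyp_def coords_def complex_eq_iff)

text \<open>The upper bound on x is the smallest radius of the class, so the square root in
  \<open>hyp\<close> is real at every frequency.\<close>

locale hypotheses =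
  fixes \<beta> :: real and K :: nat and x :: real
  assumes beta: "0 \<le> \<beta>" "\<beta> < 1 / 2" and K: "2 \<le> K" and x: "0 \<le> x" "x \<le> real K powr (-\<beta>)"
begin

abbreviation rad :: "nat \<Rightarrow> real" where "rad k \<equiv> real k powr (-\<beta>)"

lemma rad_bounds:
  assumes "k \<in> {1..K}"
  shows "0 < rad k" "x \<le> rad k" "x\<^sup>2 \<le> (rad k)\<^sup>2"
proof -
  show "0 < rad k" using assms by simp
  have "real K powr (-\<beta>) \<le> real k powr (-\<beta>)"
    by (rule powr_mono2') (use assms beta in auto)
  thus "x \<le> rad k" using x by simp
  thus "x\<^sup>2 \<le> (rad k)\<^sup>2" using x by (intro power_mono) auto
qed

lemma norm_cz_hyp: "k \<in> {1..K} \<Longrightarrow> cmod (cz (hyp \<beta> K x \<tau>) k) = rad k"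
  using rad_bounds[of k] by (auto simp: cz_hyp cmod_def)

lemma hyp_in_class: "hyp \<beta> K x \<tau> \<in> param_class \<beta> K"
proof -
  have "r (hyp \<beta> K x \<tau>) k = rad k" if "k \<in> {1..K}" for k
    using norm_cz_hyp[OF that, of \<tau>] by (simp add: r_def cz_def cmod_def)
  thus ?thesis by (auto simp: param_class_def vecs_def space_PiM hyp_def)
qed

lemma cz_hyp_flip:
  assumes "k \<in> {1..K}" "k \<noteq> l"
  shows "cz (hyp \<beta> K x (flip l \<tau>)) k = cz (hyp \<beta> K x \<tau>) k"
  using assms by (auto simp: cz_hyp flip_def)

lemma sq_norm_hyp_diff:
  assumes l: "l \<in> halves K"
  shows "sq_norm K (\<lambda>p. hyp \<beta> K x (flip l \<tau>) p - hyp \<beta> K x \<tau> p) = 4 * x\<^sup>2"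
proof -
  have cz_diff: "cz (\<lambda>p. \<theta> p - \<theta>' p) k = cz \<theta> k - cz \<theta>' k" for \<theta> \<theta>' k
    by (simp add: cz_def complex_eq_iff)
  have "sq_norm K (\<lambda>p. hyp \<beta> K x (flip l \<tau>) p - hyp \<beta> K x \<tau> p)
      = (\<Sum>k\<in>{1..K}. if k = l then 4 * x\<^sup>2 else 0)"
    unfolding sq_norm_cz cz_diff
  proof (rule sum.cong[OF refl])
    fix k assume k: "k \<in> {1..K}"
    show "(cmod (cz (hyp \<beta> K x (flip l \<tau>)) k - cz (hyp \<beta> K x \<tau>) k))\<^sup>2 = (if k = l then 4 * x\<^sup>2 else 0)"
      using k l cz_hyp_flip[OF k, of l \<tau>]
      by (cases "k = l") (auto simp: cz_hyp flip_def cmod_power2)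
  qed
  thus ?thesis using half_in[OF l] by simp
qed

lemma sq_norm_hyp: "sq_norm K (hyp \<beta> K x \<tau>) = (\<Sum>k\<in>{1..K}. (rad k)\<^sup>2)"
  unfolding sq_norm_cz by (intro sum.cong refl) (simp add: norm_cz_hyp)

text \<open>Comparison with an integral: by the mean value theorem and monotonicity, each term is at
  most the increment of \<open>n powr e / e\<close> with e = 1 - 2 \<beta>, and the increments
  telescope.\<close>

lemma sum_rad_square_le: "(\<Sum>k\<in>{1..n}. (rad k)\<^sup>2) \<le> real n powr (1 - 2 * \<beta>) / (1 - 2 * \<beta>)"
proof (induction n)
  case (Suc n)
  define e where "e = 1 - 2 * \<beta>"
  have e: "0 < e" "e \<le> 1" using beta by (auto simp: e_def)
  have step: "(rad (Suc n))\<^sup>2 \<le> (real (Suc n) powr e - real n powr e) / e"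
  proof (cases "n = 0")
    case True
    thus ?thesis using e by (simp add: field_simps)
  next
    case False
    have "\<exists>z>real n. z < real (Suc n) \<and> real (Suc n) powr e - real n powr e = (real (Suc n) - real n) * (e * z powr (e - 1))"
      by (rule MVT2) (use False in \<open>auto intro!: has_real_derivative_powr\<close>)
    then obtain z where z: "real n < z" "z < real (Suc n)"
      "real (Suc n) powr e - real n powr e = e * z powr (e - 1)" by auto
    have "(rad (Suc n))\<^sup>2 = real (Suc n) powr (e - 1)"
      by (simp add: power2_eq_square powr_add[symmetric] e_def)
    also have "\<dots> \<le> z powr (e - 1)"
      using z e False by (intro powr_mono2') auto
    also have "\<dots> = (real (Suc n) powr e - real n powr e) / e" using z(3) e by simp
    finally show ?thesis .
  qed
  have "(\<Sum>k\<in>{1..Suc n}. (rad k)\<^sup>2) = (\<Sum>k\<in>{1..n}. (rad k)\<^sup>2) + (rad (Suc n))\<^sup>2" by simp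
  also have "\<dots> \<le> real n powr e / e + (real (Suc n) powr e - real n powr e) / e"
    using Suc.IH step by (intro add_mono) (auto simp: e_def)
  finally show ?case by (simp add: e_def diff_divide_distrib)
qed simp

section \<open>The loss on a pair of frequencies\<close>

definition loc :: "nat \<Rightarrow> real \<Rightarrow> vec \<Rightarrow> vec \<Rightarrow> real" where
  "loc l \<alpha> \<theta> v = (cmod (cz \<theta> (l div 2) - cis (real (l div 2) * \<alpha>) * cz v (l div 2)))\<^sup>2
     + (cmod (cz \<theta> l - cis (real l * \<alpha>) * cz v l))\<^sup>2"

(* Rational angles suffice by continuity, and make the infimum measurable in v. *)
definition pair_loss :: "nat \<Rightarrow> vec \<Rightarrow> vec \<Rightarrow> real" where
  "pair_loss l \<theta> v = (INF \<alpha>\<in>\<rat>. loc l \<alpha> \<theta> v)"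

lemma loc_nonneg: "0 \<le> loc l \<alpha> \<theta> v" by (simp add: loc_def)

lemma bdd_loc: "bdd_below ((\<lambda>\<alpha>. loc l \<alpha> \<theta> v) ` A)"
  by (rule bdd_belowI2[where m=0]) (rule loc_nonneg)

lemma pair_loss_nonneg: "0 \<le> pair_loss l \<theta> v"
  unfolding pair_loss_def by (rule cINF_greatest) (auto intro: loc_nonneg Rats_0)

lemma pair_loss_le: "pair_loss l \<theta> v \<le> loc l \<alpha> \<theta> v"
proof -
  have "continuous_on UNIV (\<lambda>\<alpha>. loc l \<alpha> \<theta> v)"
    unfolding loc_def by (intro continuous_intros)
  hence cl: "closed {\<alpha>. pair_loss l \<theta> v \<le> loc l \<alpha> \<theta> v}"
    by (intro closed_Collect_le continuous_on_const)
  have "\<rat> \<subseteq> {\<alpha>. pair_loss l \<theta> v \<le> loc l \<alpha> \<theta> v}"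
    unfolding pair_loss_def by (auto intro!: cINF_lower bdd_loc)
  from closure_minimal[OF this cl] show ?thesis by (auto simp: Rats_closure_real)
qed

lemma pair_loss_measurable:
  assumes l: "l \<in> halves K"
  shows "pair_loss l \<theta> \<in> borel_measurable (vecs K)"
proof -
  have [measurable]: "(\<lambda>v. v p) \<in> borel_measurable (vecs K)" if "p \<in> coords K" for p
    unfolding vecs_def using that by (rule measurable_component_singleton)
  have c: "(l, 1) \<in> coords K" "(l, 2) \<in> coords K" "(l div 2, 1) \<in> coords K" "(l div 2, 2) \<in> coords K"
    using half_in[OF l] by (auto simp: coords_def)
  note m[measurable] = this[THEN \<open>\<And>p. p \<in> coords K \<Longrightarrow> (\<lambda>v. v p) \<in> borel_measurable (vecs K)\<close>]
  show ?thesis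
    unfolding pair_loss_def
  proof (rule borel_measurable_cINF_real[OF countable_rat])
    fix \<alpha> :: real
    show "loc l \<alpha> \<theta> \<in> borel_measurable (vecs K)"
      unfolding loc_def cmod_power2 cz_def by (simp del: One_nat_def) measurable
  qed
qed

text \<open>The loss uses one rotation for all frequencies; letting each pair choose its own only
  lowers the sum. Disjointness of the pairs ensures that no frequency is counted twice.\<close>

lemma sum_pair_loss_le: "(\<Sum>l\<in>halves K. pair_loss l \<theta> v) \<le> loss K \<theta> v"
proof -
  obtain \<alpha> where a: "loss K \<theta> v = sq_norm K (\<lambda>p. \<theta> p - g_apply K \<alpha> v p)"
    using loss_attained by blast
  define h where "h k = (cmod (cz \<theta> k - cis (real k * \<alpha>) * cz v k))\<^sup>2" for k
  have inj: "inj_on (\<lambda>l. l div 2) (halves K)"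
    by (rule inj_onI) (metis half_in(3))
  have "(\<Sum>l\<in>halves K. pair_loss l \<theta> v) \<le> (\<Sum>l\<in>halves K. h (l div 2) + h l)"
    unfolding h_def using pair_loss_le[of _ \<theta> v \<alpha>] by (intro sum_mono) (simp add: loc_def)
  also have "\<dots> = (\<Sum>k\<in>(\<lambda>l. l div 2) ` halves K. h k) + (\<Sum>k\<in>halves K. h k)"
    by (simp add: sum.distrib sum.reindex[OF inj])
  also have "\<dots> = (\<Sum>k\<in>(\<lambda>l. l div 2) ` halves K \<union> halves K. h k)"
    by (rule sum.union_disjoint[symmetric]) (auto dest: half_in(2))
  also have "\<dots> \<le> (\<Sum>k\<in>{1..K}. h k)"
  proof (rule sum_mono2)
    show "(\<lambda>l. l div 2) ` halves K \<union> halves K \<subseteq> {1..K}" using half_in(1,4) by blast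
  qed (auto simp: h_def)
  also have "\<dots> = loss K \<theta> v" unfolding a sq_norm_diff_g_apply h_def ..
  finally show ?thesis .
qed

text \<open>Let u be the relative rotation at frequency l/2, which acts as u^2 at l. Both hypotheses
  agree at l/2, so the errors there bound \<open>rad k * cmod (1 - u)\<close>; those at l bound the
  distance from z to u^2 z'. Since |1 - u^2| \<le> 2 |1 - u| and the radii decrease, the distance 2
  x of z and z' is at most b1 + b2 + 2 (a1 + a2).\<close>

lemma loc_separation:
  assumes l: "l \<in> halves K"
  shows "2 / 5 * x\<^sup>2 \<le> loc l \<alpha> (hyp \<beta> K x \<tau>) v + loc l \<alpha>' (hyp \<beta> K x (flip l \<tau>)) v"
proof -
  define k where "k = l div 2"
  have lk: "l = 2 * k" using half_in(3)[OF l] by (simp add: k_def)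
  define z z' w where "z = cz (hyp \<beta> K x \<tau>) l" and "z' = cz (hyp \<beta> K x (flip l \<tau>)) l"
    and "w = complex_of_real (rad k)"
  have w: "cz (hyp \<beta> K x \<tau>) k = w" "cz (hyp \<beta> K x (flip l \<tau>)) k = w"
    using half_in(1,2)[OF l] by (simp_all add: cz_hyp w_def k_def)
  define e e' where "e = cis (real k * \<alpha>)" and "e' = cis (real k * \<alpha>')"
  have el: "cis (real l * \<alpha>) = e\<^sup>2" "cis (real l * \<alpha>') = e'\<^sup>2"
    by (simp_all add: e_def e'_def lk power2_eq_square cis_mult mult_ac)
  have ne: "cmod e = 1" "cmod e' = 1" "cmod z' = rad l" "e' \<noteq> 0"
    using norm_cz_hyp half_in(4)[OF l] by (auto simp: e_def e'_def z'_def)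
  define a1 b1 a2 b2 where "a1 = cmod (w - e * cz v k)" and "b1 = cmod (z - e\<^sup>2 * cz v l)"
    and "a2 = cmod (w - e' * cz v k)" and "b2 = cmod (z' - e'\<^sup>2 * cz v l)"
  have k1: "k \<in> {1..K}" unfolding k_def by (rule half_in(1)[OF l])
  have rl: "rad l \<le> rad k"
    by (rule powr_mono2') (use beta k1 in \<open>auto simp: lk\<close>)
  define u where "u = e / e'"
  have nu: "cmod u = 1" using ne by (simp add: u_def norm_divide)
  have ue: "u * e' = e" using ne by (simp add: u_def)
  have A: "rad k * cmod (1 - u) \<le> a1 + a2"
  proof -
    have "w * (1 - u) = (w - e * cz v k) - u * (w - e' * cz v k)"
      by (simp add: algebra_simps ue[symmetric])
    hence "cmod (w * (1 - u)) \<le> a1 + cmod (u * (w - e' * cz v k))"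
      unfolding a1_def by (metis norm_triangle_ineq4)
    thus ?thesis by (simp add: norm_mult nu w_def a2_def)
  qed
  have B: "cmod (z - u\<^sup>2 * z') \<le> b1 + b2"
  proof -
    have "z - u\<^sup>2 * z' = (z - e\<^sup>2 * cz v l) - u\<^sup>2 * (z' - e'\<^sup>2 * cz v l)"
      by (simp add: algebra_simps ue[symmetric] power_mult_distrib)
    hence "cmod (z - u\<^sup>2 * z') \<le> b1 + cmod (u\<^sup>2 * (z' - e'\<^sup>2 * cz v l))"
      unfolding b1_def by (metis norm_triangle_ineq4)
    thus ?thesis by (simp add: norm_mult norm_power nu b2_def)
  qed
  have "z - z' = Complex 0 (2 * x) \<or> z - z' = Complex 0 (- (2 * x))"
    unfolding z_def z'_def cz_hyp[OF half_in(4)[OF l]] using l by (auto simp: flip_def complex_eq_iff)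
  hence "2 * x = cmod (z - z')"
    using x by (elim disjE) (simp_all add: cmod_def real_sqrt_mult)
  also have "z - z' = (z - u\<^sup>2 * z') - (1 - u) * (1 + u) * z'"
    by (simp add: algebra_simps power2_eq_square)
  also have "cmod \<dots> \<le> cmod (z - u\<^sup>2 * z') + cmod (1 - u) * cmod (1 + u) * rad l"
    by (rule order_trans[OF norm_triangle_ineq4]) (simp add: norm_mult ne)
  also have "\<dots> \<le> (b1 + b2) + cmod (1 - u) * 2 * rad k"
    using B rl norm_triangle_ineq[of 1 u] nu
    by (intro add_mono mult_mono mult_left_mono) auto
  also have "\<dots> \<le> (b1 + b2) + 2 * (a1 + a2)" using A by (simp add: algebra_simps)
  finally have "2 * x \<le> b1 + b2 + 2 * (a1 + a2)" .
  hence "(2 * x)\<^sup>2 \<le> (b1 + b2 + 2 * (a1 + a2))\<^sup>2" using x by (intro power_mono) auto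
  \<comment> \<open>Cauchy-Schwarz with weights 1, 1, 2, 2, whose squares add up to 10; the identity
    below is that of Lagrange. This gives the constant 4/10 = 2/5.\<close>
  also have "\<dots> \<le> 10 * (a1\<^sup>2 + b1\<^sup>2 + (a2\<^sup>2 + b2\<^sup>2))"
  proof -
    have "10 * (a1\<^sup>2 + b1\<^sup>2 + (a2\<^sup>2 + b2\<^sup>2)) - (b1 + b2 + 2 * (a1 + a2))\<^sup>2
        = (b1 - b2)\<^sup>2 + (2 * b1 - a1)\<^sup>2 + (2 * b1 - a2)\<^sup>2 + (2 * b2 - a1)\<^sup>2 + (2 * b2 - a2)\<^sup>2 + 4 * (a1 - a2)\<^sup>2"
      by (simp add: power2_eq_square algebra_simps)
    thus ?thesis by (smt (verit) zero_le_power2)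
  qed
  also have "a1\<^sup>2 + b1\<^sup>2 + (a2\<^sup>2 + b2\<^sup>2) = loc l \<alpha> (hyp \<beta> K x \<tau>) v + loc l \<alpha>' (hyp \<beta> K x (flip l \<tau>)) v"
    unfolding loc_def k_def[symmetric] w z_def[symmetric] z'_def[symmetric] el e_def[symmetric] e'_def[symmetric]
      a1_def b1_def a2_def b2_def ..
  finally show ?thesis by (simp add: power_mult_distrib)
qed

text \<open>The two angles in \<open>loc_separation\<close> are unrelated, so the infima can be
  taken one after the other.\<close>

lemma pair_loss_separation:
  assumes l: "l \<in> halves K"
  shows "2 / 5 * x\<^sup>2 \<le> pair_loss l (hyp \<beta> K x \<tau>) v + pair_loss l (hyp \<beta> K x (flip l \<tau>)) v"
proof -
  have ne: "(\<rat> :: real set) \<noteq> {}" using Rats_0 by blast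
  have "2 / 5 * x\<^sup>2 - loc l \<alpha>' (hyp \<beta> K x (flip l \<tau>)) v \<le> pair_loss l (hyp \<beta> K x \<tau>) v" for \<alpha>'
    unfolding pair_loss_def
    by (rule cINF_greatest[OF ne]) (use loc_separation[OF l, of _ \<tau> v \<alpha>'] in \<open>simp add: algebra_simps\<close>)
  hence "2 / 5 * x\<^sup>2 - pair_loss l (hyp \<beta> K x \<tau>) v \<le> pair_loss l (hyp \<beta> K x (flip l \<tau>)) v"
    unfolding pair_loss_def[of l "hyp \<beta> K x (flip l \<tau>)"]
    by (intro cINF_greatest[OF ne]) (simp add: algebra_simps)
  thus ?thesis by simp
qed

end

text \<open>The worst case is at least the average over all sign patterns. For fixed l,
  \<open>flip l\<close> permutes the patterns, so the sum of
  \<open>I \<tau> l + I (flip l \<tau>) l\<close> counts each term twice; this is the factor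
  2.\<close>

lemma assouad_average:
  fixes R s :: ennreal and I :: "'a set \<Rightarrow> 'a \<Rightarrow> ennreal"
  assumes "finite T"
    and R: "\<And>\<tau>. \<tau> \<subseteq> T \<Longrightarrow> (\<Sum>l\<in>T. I \<tau> l) \<le> R"
    and s: "\<And>\<tau> l. \<tau> \<subseteq> T \<Longrightarrow> l \<in> T \<Longrightarrow> s \<le> I \<tau> l + I (flip l \<tau>) l"
  shows "of_nat (card T) * s \<le> 2 * R"
proof -
  have fl: "(\<Sum>\<tau>\<in>Pow T. I (flip l \<tau>) l) = (\<Sum>\<tau>\<in>Pow T. I \<tau> l)" if "l \<in> T" for l
    by (rule sum.reindex_bij_witness[where i="flip l" and j="flip l"])
       (use that in \<open>auto simp: flip_def\<close>)
  have "of_nat (card (Pow T)) * (of_nat (card T) * s) = (\<Sum>l\<in>T. \<Sum>\<tau>\<in>Pow T. s)"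
    by (simp add: ac_simps)
  also have "\<dots> \<le> (\<Sum>l\<in>T. \<Sum>\<tau>\<in>Pow T. I \<tau> l + I (flip l \<tau>) l)"
    by (intro sum_mono s) auto
  also have "\<dots> = 2 * (\<Sum>l\<in>T. \<Sum>\<tau>\<in>Pow T. I \<tau> l)"
    by (simp add: sum.distrib fl mult_2)
  also have "\<dots> = 2 * (\<Sum>\<tau>\<in>Pow T. \<Sum>l\<in>T. I \<tau> l)"
    by (subst sum.swap) simp
  also have "\<dots> \<le> 2 * (\<Sum>\<tau>\<in>Pow T. R)"
    by (intro mult_left_mono sum_mono R) auto
  also have "\<dots> = of_nat (card (Pow T)) * (2 * R)"
    by (simp add: ac_simps)
  \<comment> \<open>The number of sign patterns is neither 0 nor infinite, so it can be cancelled in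
    \<open>ennreal\<close>.\<close>
  finally show ?thesis
    using \<open>finite T\<close> by (subst (asm) ennreal_mult_le_mult_iff) (auto simp: card_Pow ennreal_of_nat_eq_real_of_nat)
qed

section \<open>The minimax lower bound\<close>

locale rotation_hypotheses = hypotheses \<beta> K x + rotation_model K \<sigma> for \<beta> K x \<sigma>
begin

abbreviation density_hyp :: "nat set \<Rightarrow> vec \<Rightarrow> real" where
  "density_hyp \<tau> \<equiv> mix (orbit (hyp \<beta> K x \<tau>))"

lemma chi_square_high_snr:
  assumes "l \<in> halves K"
  shows "(\<integral>\<^sup>+y. ennreal ((density_hyp (flip l \<tau>) y)\<^sup>2 / density_hyp \<tau> y) \<partial>Q)
    \<le> ennreal (exp (4 * x\<^sup>2 / \<sigma>\<^sup>2))"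
  by (rule chi_square_coupling[OF adm_orbit adm_orbit])
     (simp add: orbit_diff_sq_norm sq_norm_hyp_diff[OF assms])

text \<open>An upper bound for the squared norm of any hypothesis over the noise variance, by
  \<open>sum_rad_square_le\<close>. The divisor 1 - 2 \<beta> is how the constants of the theorem
  come to depend on \<beta>.\<close>

definition snr :: real where
  "snr = real K powr (1 - 2 * \<beta>) / (1 - 2 * \<beta>) / \<sigma>\<^sup>2"

lemma snr_pos: "0 < snr"
  using beta K sigma_pos by (simp add: snr_def)

lemma sum_rad_square_le_snr: "(\<Sum>k\<in>{1..K}. (rad k)\<^sup>2) / \<sigma>\<^sup>2 \<le> snr"
  unfolding snr_def by (rule divide_right_mono[OF sum_rad_square_le]) simp

text \<open>Self-overlaps depend only on the radii, so both are equal. In the cross overlap only the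
  phase at l is shifted. The left side is therefore twice the difference estimated by
  \<open>phase_shift_bound\<close>.\<close>

lemma overlap_gap:
  assumes l: "l \<in> halves K"
  shows "overlap (orbit (hyp \<beta> K x \<tau>)) (orbit (hyp \<beta> K x \<tau>))
       + overlap (orbit (hyp \<beta> K x (flip l \<tau>))) (orbit (hyp \<beta> K x (flip l \<tau>)))
       - 2 * overlap (orbit (hyp \<beta> K x \<tau>)) (orbit (hyp \<beta> K x (flip l \<tau>)))
     \<le> 8 * x\<^sup>2 / \<sigma>\<^sup>2 * (real K powr (1 - 2 * \<beta>) / \<sigma>\<^sup>2 * snr / real K) * exp (3 * snr)"
proof -
  let ?UU = "unif \<Otimes>\<^sub>M unif" and ?\<gamma> = "\<lambda>w. snd w - fst w :: real"
  let ?A = "{1..K} - {l}"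
  let ?a = "\<lambda>k. (rad k)\<^sup>2 / \<sigma>\<^sup>2"
  have lK: "l \<in> {1..K}" "K < 2 * l" using l by (auto simp: halves_def)
  interpret circ: circle_variable ?UU ?\<gamma> by (rule circle_variable_difference)
  interpret cp: cosine_polynomial ?UU ?\<gamma> ?A ?a
    by unfold_locales auto
  have split: "(\<Sum>k\<in>{1..K}. f k) = (\<Sum>k\<in>?A. f k) + f l" for f :: "nat \<Rightarrow> real"
    using lK(1) by (subst sum.remove[of _ l]) auto
  define c where "c = sqrt ((rad l)\<^sup>2 - x\<^sup>2)"
  define s where "s = (if l \<in> \<tau> then x else - x)"
  have rl: "0 < rad l" and xr: "x\<^sup>2 \<le> (rad l)\<^sup>2" using rad_bounds[OF lK(1)] by auto
  have c2: "c\<^sup>2 = (rad l)\<^sup>2 - x\<^sup>2" using xr by (simp add: c_def)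
  have s2: "s\<^sup>2 = x\<^sup>2" by (simp add: s_def)
  \<comment> \<open>The shift t is the phase between the conjugate points c + i s and c - i s: the
    cross term is (c - i s)^2, of modulus \<open>(rad l)\<^sup>2\<close>.\<close>
  have "((c\<^sup>2 - s\<^sup>2) / (rad l)\<^sup>2)\<^sup>2 + (- (2 * s * c) / (rad l)\<^sup>2)\<^sup>2 = ((c\<^sup>2 + s\<^sup>2) / (rad l)\<^sup>2)\<^sup>2"
    unfolding power_divide add_divide_distrib[symmetric] by (simp add: power2_eq_square algebra_simps)
  also have "\<dots> = 1" using rl by (simp add: c2 s2)
  finally obtain t where t: "(c\<^sup>2 - s\<^sup>2) / (rad l)\<^sup>2 = cos t" "- (2 * s * c) / (rad l)\<^sup>2 = sin t"
    using sincos_total_2pi by metis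
  have ct: "(rad l)\<^sup>2 * cos t = c\<^sup>2 - s\<^sup>2" "(rad l)\<^sup>2 * sin t = - (2 * s * c)"
    unfolding t[symmetric] using rl by simp_all
  have same: "overlap (orbit (hyp \<beta> K x \<tau>')) (orbit (hyp \<beta> K x \<tau>'))
      = integral\<^sup>L ?UU (\<lambda>w. exp (cp.X w + ?a l * cos (real l * ?\<gamma> w)))" for \<tau>'
  proof -
    have "ip (orbit (hyp \<beta> K x \<tau>') u) (orbit (hyp \<beta> K x \<tau>') v)
        = (\<Sum>k\<in>{1..K}. (rad k)\<^sup>2 * cos (real k * (v - u)))" for u v
      unfolding ip_orbit
    proof (rule sum.cong[OF refl])
      fix k assume k: "k \<in> {1..K}"
      have "cnj (cz (hyp \<beta> K x \<tau>') k) * cz (hyp \<beta> K x \<tau>') k = of_real ((rad k)\<^sup>2)"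
        using norm_cz_hyp[OF k, of \<tau>'] complex_norm_square[of "cz (hyp \<beta> K x \<tau>') k"]
        by (simp add: mult.commute)
      thus "Re (cnj (cz (hyp \<beta> K x \<tau>') k) * cz (hyp \<beta> K x \<tau>') k) * cos (real k * (v - u))
          - Im (cnj (cz (hyp \<beta> K x \<tau>') k) * cz (hyp \<beta> K x \<tau>') k) * sin (real k * (v - u))
          = (rad k)\<^sup>2 * cos (real k * (v - u))" by simp
    qed
    from this[unfolded split] show ?thesis
      unfolding overlap_def cp.X_def by (simp add: add_divide_distrib sum_divide_distrib)
  qed
  have cross: "overlap (orbit (hyp \<beta> K x \<tau>)) (orbit (hyp \<beta> K x (flip l \<tau>)))
      = integral\<^sup>L ?UU (\<lambda>w. exp (cp.X w + ?a l * cos (real l * ?\<gamma> w + t)))"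
  proof -
    have "ip (orbit (hyp \<beta> K x \<tau>) u) (orbit (hyp \<beta> K x (flip l \<tau>)) v)
        = (\<Sum>k\<in>?A. (rad k)\<^sup>2 * cos (real k * (v - u))) + (rad l)\<^sup>2 * cos (real l * (v - u) + t)" for u v
      unfolding ip_orbit split
    proof (rule arg_cong2[where f="(+)"], rule sum.cong[OF refl])
      fix k assume k: "k \<in> ?A"
      have "cnj (cz (hyp \<beta> K x \<tau>) k) * cz (hyp \<beta> K x (flip l \<tau>)) k = of_real ((rad k)\<^sup>2)"
        using norm_cz_hyp[of k \<tau>] complex_norm_square[of "cz (hyp \<beta> K x \<tau>) k"] cz_hyp_flip[of k l \<tau>] k
        by (simp add: mult.commute)
      thus "Re (cnj (cz (hyp \<beta> K x \<tau>) k) * cz (hyp \<beta> K x (flip l \<tau>)) k) * cos (real k * (v - u))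
          - Im (cnj (cz (hyp \<beta> K x \<tau>) k) * cz (hyp \<beta> K x (flip l \<tau>)) k) * sin (real k * (v - u))
          = (rad k)\<^sup>2 * cos (real k * (v - u))" by simp
    next
      have z: "cz (hyp \<beta> K x \<tau>) l = Complex c s" "cz (hyp \<beta> K x (flip l \<tau>)) l = Complex c (- s)"
        unfolding cz_hyp[OF lK(1)] using l by (auto simp: c_def s_def flip_def)
      have "(rad l)\<^sup>2 * cos (real l * (v - u) + t)
          = (rad l)\<^sup>2 * cos t * cos (real l * (v - u)) - (rad l)\<^sup>2 * sin t * sin (real l * (v - u))"
        unfolding cos_add by (simp add: right_diff_distrib mult.assoc)
      also have "\<dots> = Re (cnj (cz (hyp \<beta> K x \<tau>) l) * cz (hyp \<beta> K x (flip l \<tau>)) l) * cos (real l * (v - u))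
          - Im (cnj (cz (hyp \<beta> K x \<tau>) l) * cz (hyp \<beta> K x (flip l \<tau>)) l) * sin (real l * (v - u))"
        unfolding ct z by (simp add: power2_eq_square algebra_simps)
      finally show "Re (cnj (cz (hyp \<beta> K x \<tau>) l) * cz (hyp \<beta> K x (flip l \<tau>)) l) * cos (real l * (v - u))
          - Im (cnj (cz (hyp \<beta> K x \<tau>) l) * cz (hyp \<beta> K x (flip l \<tau>)) l) * sin (real l * (v - u))
          = (rad l)\<^sup>2 * cos (real l * (v - u) + t)" ..
    qed
    thus ?thesis
      unfolding overlap_def cp.X_def by (simp add: add_divide_distrib sum_divide_distrib)
  qed
  let ?M = "real K powr (1 - 2 * \<beta>) / \<sigma>\<^sup>2"
  have M: "real k * ?a k \<le> ?M" if "k \<in> ?A" for k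
  proof -
    have "real k * (rad k)\<^sup>2 = real k powr (1 - 2 * \<beta>)"
      using that by (simp add: power2_eq_square powr_add[symmetric] powr_mult_base)
    also have "\<dots> \<le> real K powr (1 - 2 * \<beta>)"
      using that beta by (intro powr_mono2) auto
    finally show ?thesis by (simp add: divide_right_mono)
  qed
  have noA: "q * l \<notin> ?A" if "0 < q" for q
  proof (cases "q = 1")
    case False
    hence "2 * l \<le> q * l" using that by (intro mult_right_mono) auto
    hence "K < q * l" using lK(2) by linarith
    thus ?thesis by simp
  qed simp
  have Ss: "cp.S + ?a l = (\<Sum>k\<in>{1..K}. (rad k)\<^sup>2) / \<sigma>\<^sup>2"
    unfolding cp.S_def split by (simp add: add_divide_distrib sum_divide_distrib)
  have S: "cp.S \<le> snr" "?a l \<le> snr" "0 \<le> cp.S"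
  proof -
    have "0 \<le> ?a l" by simp
    thus "cp.S \<le> snr" "?a l \<le> snr" "0 \<le> cp.S"
      using Ss sum_rad_square_le_snr cp.S_nonneg by linarith+
  qed
  \<comment> \<open>The amplitude at frequency l combines with the shift to the squared separation:
    rad^2 - (c^2 - s^2) = 2 x^2.\<close>
  have ct1: "(1 - cos t) * ?a l = 2 * x\<^sup>2 / \<sigma>\<^sup>2"
  proof -
    have "(1 - cos t) * (rad l)\<^sup>2 = 2 * x\<^sup>2"
      using ct(1) c2 s2 by (simp add: algebra_simps)
    thus ?thesis by simp
  qed
  have "integral\<^sup>L ?UU (\<lambda>w. exp (cp.X w + ?a l * cos (real l * ?\<gamma> w)))
      - integral\<^sup>L ?UU (\<lambda>w. exp (cp.X w + ?a l * cos (real l * ?\<gamma> w + t)))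
      \<le> (1 - cos t) * (?M * cp.S * exp cp.S / real l) * ?a l * exp (2 * ?a l)"
    by (rule cp.phase_shift_bound[OF M _ _ _ noA]) (use lK in auto)
  also have "\<dots> = 2 * x\<^sup>2 / \<sigma>\<^sup>2 * (?M * cp.S * exp cp.S / real l) * exp (2 * ?a l)"
    unfolding ct1[symmetric] by (simp add: ac_simps)
  \<comment> \<open>Here l > K/2 replaces 1 / l by 2 / K. Of the exponent 3 \<open>snr\<close>, one
    part comes from the frequencies other than l and two from l itself.\<close>
  also have "\<dots> \<le> 2 * x\<^sup>2 / \<sigma>\<^sup>2 * (?M * snr * exp snr / (real K / 2)) * exp (2 * snr)"
    using S lK K snr_pos
    by (intro mult_mono mult_left_mono frac_le) auto
  also have "\<dots> = 4 * x\<^sup>2 / \<sigma>\<^sup>2 * (?M * snr / real K) * exp (3 * snr)"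
  proof -
    have "exp (3 * snr) = exp snr * exp (2 * snr)" by (simp add: exp_add[symmetric])
    thus ?thesis by (simp add: field_simps)
  qed
  finally show ?thesis unfolding same cross by simp
qed

text \<open>The lower bound on the mixture density contributes one more \<open>exp snr\<close>, for
  a total exponent of 4 \<open>snr\<close>. Outside the exponentials, two factors K^(1 - 2 \<beta>)
  and one 1 / K combine to K^(1 - 4 \<beta>), with a division by sigma^2 three times.\<close>

lemma chi_square_low_snr:
  assumes l: "l \<in> halves K"
  shows "(\<integral>\<^sup>+y. ennreal ((density_hyp (flip l \<tau>) y)\<^sup>2 / density_hyp \<tau> y) \<partial>Q)
    \<le> ennreal (1 + 8 / (1 - 2 * \<beta>) * x\<^sup>2 * real K powr (1 - 4 * \<beta>) / \<sigma> ^ 6 * exp (4 * snr))"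
proof -
  let ?D = "8 * x\<^sup>2 / \<sigma>\<^sup>2 * (real K powr (1 - 2 * \<beta>) / \<sigma>\<^sup>2 * snr / real K)"
  let ?R = "\<Sum>k\<in>{1..K}. (rad k)\<^sup>2"
  have R: "exp (?R / (2 * \<sigma>\<^sup>2)) \<le> exp snr"
  proof -
    have "?R / (2 * \<sigma>\<^sup>2) \<le> ?R / \<sigma>\<^sup>2"
      using sigma_pos by (intro divide_left_mono sum_nonneg) auto
    thus ?thesis using sum_rad_square_le_snr by simp
  qed
  have D0: "0 \<le> ?D" using snr_pos by simp
  have "(\<integral>\<^sup>+y. ennreal ((density_hyp (flip l \<tau>) y)\<^sup>2 / density_hyp \<tau> y) \<partial>Q)
    \<le> ennreal (1 + exp (?R / (2 * \<sigma>\<^sup>2)) *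
       (overlap (orbit (hyp \<beta> K x \<tau>)) (orbit (hyp \<beta> K x \<tau>))
       + overlap (orbit (hyp \<beta> K x (flip l \<tau>))) (orbit (hyp \<beta> K x (flip l \<tau>)))
       - 2 * overlap (orbit (hyp \<beta> K x \<tau>)) (orbit (hyp \<beta> K x (flip l \<tau>)))))"
  proof (rule chi_square_overlap[OF adm_orbit adm_orbit])
    show "(\<Sum>p\<in>coords K. (orbit (hyp \<beta> K x \<tau>) u p)\<^sup>2) = ?R" for u
      by (simp add: orbit_sq_norm sq_norm_hyp)
    show "expectation (\<lambda>u. orbit (hyp \<beta> K x \<tau>) u p) = 0" if "p \<in> coords K" for p
      unfolding orbit_def by (rule integral_g_apply[OF that])
  qed
  also have "\<dots> \<le> ennreal (1 + exp snr * (?D * exp (3 * snr)))"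
  proof (intro ennreal_leI add_left_mono)
    show "exp (?R / (2 * \<sigma>\<^sup>2)) *
       (overlap (orbit (hyp \<beta> K x \<tau>)) (orbit (hyp \<beta> K x \<tau>))
       + overlap (orbit (hyp \<beta> K x (flip l \<tau>))) (orbit (hyp \<beta> K x (flip l \<tau>)))
       - 2 * overlap (orbit (hyp \<beta> K x \<tau>)) (orbit (hyp \<beta> K x (flip l \<tau>))))
      \<le> exp snr * (?D * exp (3 * snr))"
      by (rule order_trans[OF mult_left_mono[OF overlap_gap[OF l]]], simp,
          rule mult_right_mono[OF R]) (rule mult_nonneg_nonneg[OF D0 exp_ge_zero])
  qed
  also have "exp snr * (?D * exp (3 * snr))
      = 8 / (1 - 2 * \<beta>) * x\<^sup>2 * real K powr (1 - 4 * \<beta>) / \<sigma> ^ 6 * exp (4 * snr)"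
  proof -
    have e: "exp (4 * snr) = exp snr * exp (3 * snr)" by (simp add: exp_add[symmetric])
    have "real K powr (1 - 2 * \<beta>) * real K powr (1 - 2 * \<beta>) = real K powr (1 - 4 * \<beta>) * real K"
      using K by (simp add: powr_add[symmetric] powr_mult_base mult.commute)
    hence "?D = 8 / (1 - 2 * \<beta>) * x\<^sup>2 * real K powr (1 - 4 * \<beta>) / \<sigma> ^ 6"
      using sigma_pos K beta unfolding snr_def
      by (simp add: divide_simps)
    thus ?thesis unfolding e by (simp add: ac_simps)
  qed
  finally show ?thesis .
qed

text \<open>The constant is 60 = 6 * 5 * 2: at least K/6 signs, a cost of x^2 / 5 for each by
  \<open>two_point_bound\<close>, and the factor 2 of \<open>assouad_average\<close>.\<close>

lemma minimax_risk_ge: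
  assumes \<rho>: "0 \<le> \<rho>" "\<rho> ^ N \<le> 2"
    and chi: "\<And>\<tau> l. l \<in> halves K \<Longrightarrow>
      (\<integral>\<^sup>+y. ennreal ((density_hyp (flip l \<tau>) y)\<^sup>2 / density_hyp \<tau> y) \<partial>Q) \<le> ennreal \<rho>"
  shows "ennreal (real K * x\<^sup>2 / 60) \<le> minimax_risk \<beta> K N \<sigma>"
  unfolding minimax_risk_def
proof (rule INF_greatest)
  fix est assume est: "est \<in> estimators K N"
  let ?QN = "PiM {1..N} (\<lambda>_. Q)"
  define R where "R = (SUP \<theta>\<in>param_class \<beta> K. risk K N \<sigma> est \<theta>)"
  define H where "H \<tau> l y = pair_loss l (hyp \<beta> K x \<tau>) (est y)" for \<tau> l y
  define I where "I \<tau> l = (\<integral>\<^sup>+y. (\<Prod>j\<in>{1..N}. ennreal (density_hyp \<tau> (y j))) * ennreal (H \<tau> l y) \<partial>?QN)" for \<tau> l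
  have Hm: "H \<tau> l \<in> borel_measurable (PiM {1..N} (\<lambda>_. vecs K))" if "l \<in> halves K" for \<tau> l
    unfolding H_def[abs_def]
    by (rule measurable_compose[OF _ pair_loss_measurable[OF that]]) (use est in \<open>simp add: estimators_def\<close>)
  have HmQ: "H \<tau> l \<in> borel_measurable ?QN" if "l \<in> halves K" for \<tau> l
  proof -
    have s: "sets (PiM {1..N} (\<lambda>_. vecs K)) = sets ?QN"
      by (intro sets_PiM_cong) (auto simp: vecs_def sets_Q)
    show ?thesis using Hm[OF that] measurable_cong_sets[OF s refl, of borel] by blast
  qed
  have "of_nat (card (halves K)) * ennreal (x\<^sup>2 / 5) \<le> 2 * R"
  proof (rule assouad_average[where I=I])
    fix \<tau> assume "\<tau> \<subseteq> halves K"
    have "(\<Sum>l\<in>halves K. I \<tau> l) = (\<Sum>l\<in>halves K. \<integral>\<^sup>+\<omega>. ennreal (H \<tau> l (obs K N \<sigma> (hyp \<beta> K x \<tau>) \<omega>)) \<partial>latent K N)"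
      unfolding I_def using Hm
      by (intro sum.cong refl nn_integral_obs[symmetric]) simp
    also have "\<dots> = (\<integral>\<^sup>+\<omega>. (\<Sum>l\<in>halves K. ennreal (H \<tau> l (obs K N \<sigma> (hyp \<beta> K x \<tau>) \<omega>))) \<partial>latent K N)"
      using Hm
      by (intro nn_integral_sum[symmetric] measurable_compose[OF _ measurable_ennreal]
          measurable_compose[OF obs_measurable]) auto
    also have "\<dots> \<le> risk K N \<sigma> est (hyp \<beta> K x \<tau>)"
      unfolding risk_def
    proof (rule nn_integral_mono)
      fix \<omega>
      show "(\<Sum>l\<in>halves K. ennreal (H \<tau> l (obs K N \<sigma> (hyp \<beta> K x \<tau>) \<omega>)))
          \<le> ennreal (loss K (hyp \<beta> K x \<tau>) (est (obs K N \<sigma> (hyp \<beta> K x \<tau>) \<omega>)))"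
        unfolding H_def using pair_loss_nonneg by (simp add: sum_ennreal ennreal_leI sum_pair_loss_le)
    qed
    also have "\<dots> \<le> R"
      unfolding R_def by (rule SUP_upper[OF hyp_in_class])
    finally show "(\<Sum>l\<in>halves K. I \<tau> l) \<le> R" .
  next
    fix \<tau> l assume l: "l \<in> halves K"
    have "ennreal (2 / 5 * x\<^sup>2 / 2) \<le> I \<tau> l + I (flip l \<tau>) l"
      unfolding I_def
    proof (rule two_point_bound[OF adm_orbit adm_orbit _ chi[OF l] \<rho>(1)])
      show "\<rho> ^ card {1..N} \<le> 2" using \<rho>(2) by simp
      show "2 / 5 * x\<^sup>2 \<le> H \<tau> l y + H (flip l \<tau>) l y" for y
        unfolding H_def by (rule pair_loss_separation[OF l])
      show "H \<tau> l \<in> borel_measurable ?QN" "H (flip l \<tau>) l \<in> borel_measurable ?QN"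
        by (rule HmQ[OF l])+
    qed (auto simp: H_def pair_loss_nonneg)
    thus "ennreal (x\<^sup>2 / 5) \<le> I \<tau> l + I (flip l \<tau>) l" by simp
  qed simp
  hence le: "ennreal (real (card (halves K)) * (x\<^sup>2 / 5)) \<le> 2 * R"
    by (simp add: ennreal_of_nat_eq_real_of_nat ennreal_mult[symmetric])
  show "ennreal (real K * x\<^sup>2 / 60) \<le> (SUP \<theta>\<in>param_class \<beta> K. risk K N \<sigma> est \<theta>)"
    unfolding R_def[symmetric]
  proof (cases R)
    case (real z)
    have "2 * R = ennreal (2 * z)" using real by (simp add: ennreal_mult)
    hence "real (card (halves K)) * (x\<^sup>2 / 5) \<le> 2 * z"
      using le real(1) by (simp add: ennreal_le_iff)
    moreover have "real K / 6 * (x\<^sup>2 / 5) \<le> real (card (halves K)) * (x\<^sup>2 / 5)"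
      using card_halves[OF K] by (intro mult_right_mono) auto
    ultimately show "ennreal (real K * x\<^sup>2 / 60) \<le> R"
      unfolding real(2) by (intro ennreal_leI) simp
  qed simp
qed

end

section \<open>Choice of the separation for each of the two rates\<close>

lemma exp_half_le: "exp (1 / 2 :: real) \<le> 2"
  using exp_bound_half[of "1/2 :: real"] by simp

lemma minimax_risk_ge_high_snr:
  assumes "0 \<le> \<beta>" "\<beta> < 1 / 2" "2 \<le> K" "1 \<le> N" "0 < \<sigma>"
  shows "ennreal (min (real K * \<sigma>\<^sup>2 / real N) (real K powr (1 - 2 * \<beta>)) / 960) \<le> minimax_risk \<beta> K N \<sigma>"
proof -
  \<comment> \<open>\<open>q\<close> is x^2. The first entry keeps N times the exponent below 1/2,
    since exp (1/2) \<le> 2 is the condition on \<open>\<rho> ^ N\<close>; 16 is the value that the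
    other rate uses as well. The second entry keeps x below the smallest radius and turns into K^(1
    - 2 \<beta>) after multiplication by K.\<close>
  define q where "q = min (\<sigma>\<^sup>2 / (16 * real N)) ((real K powr (-\<beta>))\<^sup>2)"
  have q0: "0 \<le> q" by (simp add: q_def)
  interpret rotation_hypotheses \<beta> K "sqrt q" \<sigma>
    by unfold_locales (use assms q0 in \<open>auto simp: q_def intro!: real_le_lsqrt\<close>)
  have "4 * q / \<sigma>\<^sup>2 * real N \<le> 4 * (\<sigma>\<^sup>2 / (16 * real N)) / \<sigma>\<^sup>2 * real N"
    by (intro mult_right_mono divide_right_mono mult_left_mono) (auto simp: q_def)
  also have "\<dots> \<le> 1 / 2" using assms by simp
  finally have "exp (4 * q / \<sigma>\<^sup>2) ^ N \<le> exp (1 / 2)"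
    by (simp add: exp_of_nat_mult[symmetric] mult.commute)
  hence "exp (4 * (sqrt q)\<^sup>2 / \<sigma>\<^sup>2) ^ N \<le> 2" using exp_half_le q0 by simp
  from minimax_risk_ge[OF _ this chi_square_high_snr]
  have "ennreal (real K * q / 60) \<le> minimax_risk \<beta> K N \<sigma>" using q0 by simp
  moreover have "min (real K * \<sigma>\<^sup>2 / real N) (real K powr (1 - 2 * \<beta>)) / 960 \<le> real K * q / 60"
  proof -
    have e: "real K powr (1 - 2 * \<beta>) = real K * (real K powr (-\<beta>))\<^sup>2"
      using assms by (simp add: power2_eq_square powr_add[symmetric] powr_mult_base)
    define p where "p = real K * (real K powr (-\<beta>))\<^sup>2"
    have "real K * q = min (real K * \<sigma>\<^sup>2 / real N / 16) p"
      by (simp add: q_def p_def min_mult_distrib_left)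
    moreover have "min y p / 960 \<le> min (y / 16) p / 60" for y :: real
    proof -
      have "0 \<le> p" by (simp add: p_def)
      thus ?thesis by (auto simp: min_def)
    qed
    ultimately show ?thesis unfolding e p_def[symmetric] by simp
  qed
  ultimately show ?thesis by (meson ennreal_leI order_trans)
qed

lemma minimax_risk_ge_low_snr:
  assumes "0 \<le> \<beta>" "\<beta> < 1 / 2" "2 \<le> K" "1 \<le> N" "0 < \<sigma>"
  shows "ennreal ((1 - 2 * \<beta>) * min (real K powr (4 * \<beta>) * \<sigma> ^ 6
      / exp (4 / (1 - 2 * \<beta>) * real K powr (1 - 2 * \<beta>) / \<sigma>\<^sup>2) / real N) (real K powr (1 - 2 * \<beta>)) / 960)
    \<le> minimax_risk \<beta> K N \<sigma>"
proof -
  define e where "e = 1 - 2 * \<beta>"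
  have e: "0 < e" "e \<le> 1" using assms by (auto simp: e_def)
  define E where "E = exp (4 / e * real K powr e / \<sigma>\<^sup>2)"
  have E0: "0 < E" by (simp add: E_def)
  \<comment> \<open>The first entry solves \<open>?z * real N = 1 / 2\<close> for \<open>q\<close>:
    16 is twice the 8 of \<open>chi_square_low_snr\<close>, and the factor \<open>e\<close> undoes
    the division by 1 - 2 \<beta> there.\<close>
  define q where "q = min (e * real K powr (4 * \<beta> - 1) * \<sigma> ^ 6 / E / (16 * real N)) ((real K powr (-\<beta>))\<^sup>2)"
  have q0: "0 \<le> q" using e E0 assms by (simp add: q_def)
  interpret rotation_hypotheses \<beta> K "sqrt q" \<sigma>
    by unfold_locales (use assms q0 in \<open>auto simp: q_def intro!: real_le_lsqrt\<close>)
  have snrE: "exp (4 * snr) = E" by (simp add: snr_def E_def e_def)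
  let ?z = "8 / e * q * real K powr (1 - 4 * \<beta>) / \<sigma> ^ 6 * E"
  have "?z * real N \<le> 8 / e * (e * real K powr (4 * \<beta> - 1) * \<sigma> ^ 6 / E / (16 * real N))
      * real K powr (1 - 4 * \<beta>) / \<sigma> ^ 6 * E * real N"
    using e E0 assms by (intro mult_right_mono divide_right_mono mult_left_mono) (auto simp: q_def)
  also have "\<dots> = 1 / 2 * (real K powr (4 * \<beta> - 1) * real K powr (1 - 4 * \<beta>))"
    using e E0 assms by simp
  also have "\<dots> = 1 / 2" using assms by (simp add: powr_add[symmetric])
  finally have zN: "?z * real N \<le> 1 / 2" .
  have z0: "0 \<le> ?z" using q0 e E0 assms by simp
  have "(1 + ?z) ^ N \<le> exp ?z ^ N"
    using z0 by (intro power_mono exp_ge_add_one_self) simp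
  also have "\<dots> \<le> exp (1 / 2)" using zN by (simp add: exp_of_nat_mult[symmetric] mult.commute)
  finally have "(1 + ?z) ^ N \<le> 2" using exp_half_le by simp
  hence "(1 + 8 / (1 - 2 * \<beta>) * (sqrt q)\<^sup>2 * real K powr (1 - 4 * \<beta>) / \<sigma> ^ 6 * exp (4 * snr)) ^ N \<le> 2"
    using q0 by (simp add: snrE e_def)
  from minimax_risk_ge[OF _ this chi_square_low_snr]
  have "ennreal (real K * q / 60) \<le> minimax_risk \<beta> K N \<sigma>" using q0 z0 by (simp add: snrE e_def)
  moreover have "e * min (real K powr (4 * \<beta>) * \<sigma> ^ 6 / E / real N) (real K powr e) / 960 \<le> real K * q / 60"
  proof -
    have k1: "real K powr e = real K * (real K powr (-\<beta>))\<^sup>2"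
      using assms by (simp add: e_def power2_eq_square powr_add[symmetric] powr_mult_base)
    have k2: "real K powr (4 * \<beta>) = real K * real K powr (4 * \<beta> - 1)"
      using assms by (simp add: powr_mult_base)
    define m where "m = min (real K powr (4 * \<beta>) * \<sigma> ^ 6 / E / real N) (real K powr e)"
    have m0: "0 \<le> m" using E0 by (auto simp: m_def)
    have "e * m / 960 \<le> real K * (e * real K powr (4 * \<beta> - 1) * \<sigma> ^ 6 / E / (16 * real N)) / 60"
    proof -
      have "e * m \<le> e * (real K powr (4 * \<beta>) * \<sigma> ^ 6 / E / real N)"
        using e by (intro mult_left_mono) (auto simp: m_def)
      thus ?thesis unfolding k2 by (simp add: field_simps)
    qed
    moreover have "e * m / 960 \<le> real K * (real K powr (-\<beta>))\<^sup>2 / 60"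
    proof -
      have "e * m \<le> 1 * real K powr e" using e m0 by (intro mult_mono) (auto simp: m_def)
      moreover have "0 \<le> real K powr e" by simp
      ultimately show ?thesis unfolding k1[symmetric] by linarith
    qed
    ultimately show ?thesis unfolding m_def[symmetric] q_def by (simp add: min_def)
  qed
  ultimately show ?thesis unfolding e_def E_def by (meson ennreal_leI order_trans)
qed

theorem lemma6p1:
  fixes \<beta> :: real
  assumes "0 \<le> \<beta>" and "\<beta> < 1 / 2"
  shows "\<exists>C c :: real. C > 0 \<and> c > 0 \<and>
    (\<forall>(K::nat) (N::nat) (\<sigma>::real). K \<ge> 2 \<longrightarrow> N \<ge> 1 \<longrightarrow> \<sigma> > 0 \<longrightarrow>
      minimax_risk \<beta> K N \<sigma> \<ge>
        ennreal (c * min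
          (1 / real N * max (real K * \<sigma>\<^sup>2)
             (real K powr (4 * \<beta>) * \<sigma> ^ 6 / exp (C * real K powr (1 - 2 * \<beta>) / \<sigma>\<^sup>2)))
          (real K powr (1 - 2 * \<beta>))))"
proof (intro exI conjI allI impI)
  \<comment> \<open>C comes from \<open>exp (4 * snr)\<close>. In c, 960 is the 60 of
    \<open>minimax_risk_ge\<close> times the 16 in the choice of x^2, and 1 - 2 \<beta> is inherited
    from the second rate.\<close>
  show "0 < 4 / (1 - 2 * \<beta>)" "0 < (1 - 2 * \<beta>) / 960" using assms by auto
  fix K N :: nat and \<sigma> :: real
  assume KN: "K \<ge> 2" "N \<ge> 1" "\<sigma> > 0"
  define a where "a = real K * \<sigma>\<^sup>2"
  define m where "m = real K powr (1 - 2 * \<beta>)"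
  define b where "b = real K powr (4 * \<beta>) * \<sigma> ^ 6 / exp (4 / (1 - 2 * \<beta>) * m / \<sigma>\<^sup>2)"
  show "ennreal ((1 - 2 * \<beta>) / 960 * min (1 / real N * max (real K * \<sigma>\<^sup>2)
        (real K powr (4 * \<beta>) * \<sigma> ^ 6 / exp (4 / (1 - 2 * \<beta>) * real K powr (1 - 2 * \<beta>) / \<sigma>\<^sup>2)))
        (real K powr (1 - 2 * \<beta>))) \<le> minimax_risk \<beta> K N \<sigma>"
    unfolding a_def[symmetric] m_def[symmetric] b_def[symmetric]
  \<comment> \<open>Both lower bounds hold for every noise level, so the one with the larger rate
    can be used, and it realizes the maximum.\<close>
  proof (cases "b \<le> a")
    case True
    have "0 \<le> min (a / real N) m" by (auto simp: a_def m_def)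
    hence "(1 - 2 * \<beta>) * min (a / real N) m \<le> 1 * min (a / real N) m"
      using assms by (intro mult_right_mono) auto
    hence "(1 - 2 * \<beta>) / 960 * min (1 / real N * max a b) m \<le> min (a / real N) m / 960"
      using True by (simp add: max_absorb1)
    thus "ennreal ((1 - 2 * \<beta>) / 960 * min (1 / real N * max a b) m) \<le> minimax_risk \<beta> K N \<sigma>"
      using minimax_risk_ge_high_snr[OF assms KN] unfolding a_def[symmetric] m_def[symmetric]
      by (meson ennreal_leI order_trans)
  next
    case False
    hence eq: "(1 - 2 * \<beta>) / 960 * min (1 / real N * max a b) m = (1 - 2 * \<beta>) * min (b / real N) m / 960"
      by (simp add: max_absorb2)
    show "ennreal ((1 - 2 * \<beta>) / 960 * min (1 / real N * max a b) m) \<le> minimax_risk \<beta> K N \<sigma>"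
      unfolding eq using minimax_risk_ge_low_snr[OF assms KN] unfolding m_def[symmetric] b_def[symmetric] .
  qed
qed

end
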